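(* Let $K$ be a compact Hausdorff space and $L$ be a nonempty compact metric space. Then the following assertions are equivalent: (1) There exist a closed linear subspace $E$ of $\mathcal{C}(K)$, a surjective positive isometry $T\colon\mathcal{C}(L)\to E$, and a positive norm-$1$ projection $P\colon\mathcal{C}(K)\to E$ (onto $E$). (2) There exist a closed subset $F$ of $K$, a continuous surjection $\rho\colon F\to L$, and a continuous mapping $\phi\colon L\to\mathcal{P}(F)$ such that $\operatorname{supp}(\phi(x))\subseteq\rho^{-1}(x)$ for each $x\in L$.
   Context: $\mathcal{C}(K)$ is the Banach lattice of continuous real functions on $K$ with the sup norm and pointwise order. Operators are linear; an operator $T$ from $\mathcal{C}(L)$ or $\mathcal{C}(K)$ into a subspace $E\subseteq\mathcal{C}(K)$ is positive if it maps nonnegative functions to nonnegative functions. A projection onto $E$ is a bounded operator $P:\mathcal{C}(K)\to E$ with $P\restriction E=\mathrm{id}_E$. $\mathcal{P}(F)$ is the set of regular Borel probability measures on $F$ with the weak$^*$ topology inherited from $\mathcal{M}(F)=\mathcal{C}(F)^*$ (regular signed Borel measures). $\operatorname{supp}(\mu)$ is the smallest closed set $S$ with $|\mu|$ vanishing on its complement. *)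

theory Defs
  imports "HOL-Analysis.Analysis" "HOL-Probability.Probability"
begin

section \<open>The Banach lattice of continuous functions\<close>

text \<open>Continuous functions on a topology are represented by total functions that vanish
  outside the carrier. The representation is unique, the vector space operations are the
  pointwise ones, and the pointwise order on the carrier is the order of the function type.
  The carrier may be empty; then there is exactly one such function.\<close>

definition cfun :: "'a topology \<Rightarrow> ('a \<Rightarrow> real) set" where
  "cfun X = {f. continuous_map X euclideanreal f \<and> (\<forall>x. x \<notin> topspace X \<longrightarrow> f x = 0)}"

text \<open>The element 0 is inserted only to get norm 0 on an empty carrier.\<close>

definition sup_norm :: "'a topology \<Rightarrow> ('a \<Rightarrow> real) \<Rightarrow> real" where
  "sup_norm X f = Sup (insert 0 ((\<lambda>x. \<bar>f x\<bar>) ` topspace X))"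

text \<open>As for the library's \<open>fdist\<close>, the value off the carrier only serves to make
  \<open>Metric_space (cfun X) (sup_dist X)\<close> hold, see \<open>Metric_space_cfun\<close> below.\<close>

definition sup_dist :: "'a topology \<Rightarrow> ('a \<Rightarrow> real) \<Rightarrow> ('a \<Rightarrow> real) \<Rightarrow> real" where
  "sup_dist X f g = (if f \<in> cfun X \<and> g \<in> cfun X then sup_norm X (\<lambda>x. f x - g x) else 0)"

definition linear_subspace :: "('a \<Rightarrow> real) set \<Rightarrow> bool" where
  "linear_subspace E \<longleftrightarrow> (\<lambda>x. 0) \<in> E \<and>
     (\<forall>f\<in>E. \<forall>g\<in>E. (\<lambda>x. f x + g x) \<in> E) \<and> (\<forall>c. \<forall>f\<in>E. (\<lambda>x. c * f x) \<in> E)"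

definition closed_linear_subspace :: "'a topology \<Rightarrow> ('a \<Rightarrow> real) set \<Rightarrow> bool" where
  "closed_linear_subspace X E \<longleftrightarrow> E \<subseteq> cfun X \<and> linear_subspace E \<and>
     closedin (Metric_space.mtopology (cfun X) (sup_dist X)) E"

definition linear_operator ::
    "('a \<Rightarrow> real) set \<Rightarrow> ('b \<Rightarrow> real) set \<Rightarrow> (('a \<Rightarrow> real) \<Rightarrow> ('b \<Rightarrow> real)) \<Rightarrow> bool" where
  "linear_operator V W T \<longleftrightarrow> T \<in> V \<rightarrow> W \<and>
     (\<forall>f\<in>V. \<forall>g\<in>V. T (\<lambda>x. f x + g x) = (\<lambda>y. T f y + T g y)) \<and>
     (\<forall>c. \<forall>f\<in>V. T (\<lambda>x. c * f x) = (\<lambda>y. c * T f y))"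

definition positive_operator ::
    "('a \<Rightarrow> real) set \<Rightarrow> (('a \<Rightarrow> real) \<Rightarrow> ('b \<Rightarrow> real)) \<Rightarrow> bool" where
  "positive_operator V T \<longleftrightarrow> (\<forall>f\<in>V. (\<forall>x. 0 \<le> f x) \<longrightarrow> (\<forall>y. 0 \<le> T f y))"

definition surjective_isometry ::
    "'a topology \<Rightarrow> 'b topology \<Rightarrow> ('b \<Rightarrow> real) set \<Rightarrow> (('a \<Rightarrow> real) \<Rightarrow> ('b \<Rightarrow> real)) \<Rightarrow> bool" where
  "surjective_isometry X Y E T \<longleftrightarrow> linear_operator (cfun X) E T \<and> T ` cfun X = E \<and>
     (\<forall>f\<in>cfun X. sup_norm Y (T f) = sup_norm X f)"

definition bounded_operator ::
    "'a topology \<Rightarrow> 'b topology \<Rightarrow> ('b \<Rightarrow> real) set \<Rightarrow> (('a \<Rightarrow> real) \<Rightarrow> ('b \<Rightarrow> real)) \<Rightarrow> bool" where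
  "bounded_operator X Y E T \<longleftrightarrow> linear_operator (cfun X) E T \<and>
     (\<exists>B. \<forall>f\<in>cfun X. sup_norm Y (T f) \<le> B * sup_norm X f)"

definition operator_norm ::
    "'a topology \<Rightarrow> 'b topology \<Rightarrow> (('a \<Rightarrow> real) \<Rightarrow> ('b \<Rightarrow> real)) \<Rightarrow> real" where
  "operator_norm X Y T = (SUP f\<in>{f \<in> cfun X. sup_norm X f \<le> 1}. sup_norm Y (T f))"

definition projection_onto ::
    "'a topology \<Rightarrow> ('a \<Rightarrow> real) set \<Rightarrow> (('a \<Rightarrow> real) \<Rightarrow> ('a \<Rightarrow> real)) \<Rightarrow> bool" where
  "projection_onto X E P \<longleftrightarrow> bounded_operator X X E P \<and> (\<forall>f\<in>E. P f = f)"


section \<open>Regular Borel probability measures\<close>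

definition borel_on :: "'a topology \<Rightarrow> 'a measure" where
  "borel_on X = sigma (topspace X) {U. openin X U}"

definition regular_measure :: "'a topology \<Rightarrow> 'a measure \<Rightarrow> bool" where
  "regular_measure X \<mu> \<longleftrightarrow> (\<forall>A\<in>sets \<mu>.
     emeasure \<mu> A = (SUP C\<in>{C. C \<in> sets \<mu> \<and> compactin X C \<and> C \<subseteq> A}. emeasure \<mu> C) \<and>
     emeasure \<mu> A = (INF U\<in>{U. openin X U \<and> A \<subseteq> U}. emeasure \<mu> U))"

definition regular_prob :: "'a topology \<Rightarrow> 'a measure set" where
  "regular_prob X = {\<mu>. sets \<mu> = sets (borel_on X) \<and> prob_space \<mu> \<and> regular_measure X \<mu>}"

text \<open>The trace on the probability measures of the weak-* topology of the dual of the
  continuous functions: the initial topology for the evaluations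
  \<open>\<mu> \<mapsto> \<integral>f d\<mu>\<close>, with \<open>f\<close> ranging over the continuous functions.\<close>

definition weak_star_prob :: "'a topology \<Rightarrow> 'a measure topology" where
  "weak_star_prob X = pullback_topology (regular_prob X)
     (\<lambda>\<mu>. \<lambda>f\<in>cfun X. \<integral>x. f x \<partial>\<mu>) (product_topology (\<lambda>_. euclideanreal) (cfun X))"

text \<open>The least element with respect to inclusion. It exists for regular measures, see \<open>measure_support_least\<close> below.\<close>

definition measure_support :: "'a topology \<Rightarrow> 'a measure \<Rightarrow> 'a set" where
  "measure_support X \<mu> = (LEAST S. closedin X S \<and> emeasure \<mu> (topspace X - S) = 0)"


section \<open>Well-definedness\<close>

lemma cfun_bdd:
  assumes "compact_space X" "f \<in> cfun X"
  shows "bdd_above (insert 0 ((\<lambda>x. \<bar>f x\<bar>) ` topspace X))"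
proof -
  have "compactin euclideanreal (f ` topspace X)"
    using assms unfolding cfun_def compact_space_def by (metis (lifting) image_compactin mem_Collect_eq)
  then have "bounded (f ` topspace X)"
    by (simp add: compact_imp_bounded compactin_euclidean_iff)
  then show ?thesis
    by (simp add: bounded_imp_bdd_above bounded_norm_comp flip: real_norm_def)
qed

lemma cfun_diff: "f \<in> cfun X \<Longrightarrow> g \<in> cfun X \<Longrightarrow> (\<lambda>x. f x - g x) \<in> cfun X"
  unfolding cfun_def by (auto intro: continuous_intros)

lemma sup_norm_upper:
  assumes "compact_space X" "f \<in> cfun X"
  shows "\<bar>f x\<bar> \<le> sup_norm X f"
proof (cases "x \<in> topspace X")
  case True
  then show ?thesis
    unfolding sup_norm_def by (intro cSup_upper cfun_bdd assms) auto
next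
  case False
  then have "\<bar>f x\<bar> = 0" using assms unfolding cfun_def by auto
  also have "0 \<le> sup_norm X f"
    unfolding sup_norm_def by (intro cSup_upper cfun_bdd assms) auto
  finally show ?thesis .
qed

lemma sup_norm_least:
  assumes "0 \<le> c" "\<And>x. x \<in> topspace X \<Longrightarrow> \<bar>f x\<bar> \<le> c"
  shows "sup_norm X f \<le> c"
  unfolding sup_norm_def using assms by (intro cSup_least) auto

lemma Metric_space_cfun:
  assumes "compact_space X"
  shows "Metric_space (cfun X) (sup_dist X)"
proof
  show "0 \<le> sup_dist X f g" for f g
    using sup_norm_upper[OF assms cfun_diff, of f g undefined] unfolding sup_dist_def by force
  show "sup_dist X f g = sup_dist X g f" for f g
    unfolding sup_dist_def sup_norm_def by (simp add: abs_minus_commute)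
  show "(sup_dist X f g = 0) = (f = g)" if "f \<in> cfun X" "g \<in> cfun X" for f g
  proof
    assume "sup_dist X f g = 0"
    then show "f = g"
      using sup_norm_upper[OF assms cfun_diff[OF that]] that unfolding sup_dist_def by fastforce
  next
    assume "f = g"
    then show "sup_dist X f g = 0"
      unfolding sup_dist_def sup_norm_def by (simp add: insert_absorb image_constant_conv)
  qed
  show "sup_dist X f h \<le> sup_dist X f g + sup_dist X g h"
    if "f \<in> cfun X" "g \<in> cfun X" "h \<in> cfun X" for f g h
  proof -
    have "\<bar>f x - h x\<bar> \<le> sup_dist X f g + sup_dist X g h" for x
      using sup_norm_upper[OF assms cfun_diff[OF that(1,2)], of x]
        sup_norm_upper[OF assms cfun_diff[OF that(2,3)], of x] that
      unfolding sup_dist_def by simp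
    moreover from this have "0 \<le> sup_dist X f g + sup_dist X g h"
      using abs_ge_zero order_trans by blast
    ultimately have "sup_norm X (\<lambda>x. f x - h x) \<le> sup_dist X f g + sup_dist X g h"
      by (intro sup_norm_least)
    then show ?thesis using that unfolding sup_dist_def by simp
  qed
qed

lemma measure_support_least:
  assumes \<mu>: "\<mu> \<in> regular_prob X"
  shows "closedin X (measure_support X \<mu>)"
    and "emeasure \<mu> (topspace X - measure_support X \<mu>) = 0"
    and "closedin X S \<Longrightarrow> emeasure \<mu> (topspace X - S) = 0 \<Longrightarrow> measure_support X \<mu> \<subseteq> S"
proof -
  let ?N = "{U. openin X U \<and> emeasure \<mu> U = 0}"
  have sets: "sets \<mu> = sigma_sets (topspace X) {U. openin X U}"
  proof -
    have "{U. openin X U} \<subseteq> Pow (topspace X)"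
      using openin_subset[of X] by blast
    then show ?thesis
      using \<mu> unfolding regular_prob_def borel_on_def by (simp add: sets_measure_of)
  qed
  then have open_sets: "U \<in> sets \<mu>" if "openin X U" for U
    using that by auto
  have oN: "openin X (\<Union>?N)" by blast
  have "emeasure \<mu> C = 0" if C: "compactin X C" "C \<subseteq> \<Union>?N" for C
  proof -
    obtain \<F> where \<F>: "finite \<F>" "\<F> \<subseteq> ?N" "C \<subseteq> \<Union>\<F>"
      using C unfolding compactin_def by (metis (no_types, lifting) mem_Collect_eq)
    have "emeasure \<mu> C \<le> emeasure \<mu> (\<Union>\<F>)"
      using \<F> open_sets by (intro emeasure_mono sets.finite_Union) auto
    also have "emeasure \<mu> (\<Union>\<F>) = 0"
    proof -
      have "\<F> \<subseteq> null_sets \<mu>"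
        using \<F>(2) open_sets by (auto simp: null_sets_def)
      with \<F>(1) have "\<Union>\<F> \<in> null_sets \<mu>"
        by (induction \<F> rule: finite_induct) auto
      then show ?thesis by auto
    qed
    finally show ?thesis by simp
  qed
  then have null: "emeasure \<mu> (\<Union>?N) = 0"
    using \<mu> open_sets[OF oN] unfolding regular_prob_def regular_measure_def
    by (auto intro!: antisym SUP_least)
  have supp: "measure_support X \<mu> = topspace X - \<Union>?N"
    unfolding measure_support_def
  proof (rule Least_equality)
    have "topspace X - (topspace X - \<Union>?N) = \<Union>?N"
      using openin_subset[OF oN] by blast
    then show "closedin X (topspace X - \<Union>?N) \<and>
        emeasure \<mu> (topspace X - (topspace X - \<Union>?N)) = 0"
      using oN null by auto
  qed blast
  show "closedin X (measure_support X \<mu>)" unfolding supp using oN by blast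
  have "topspace X - (topspace X - \<Union>?N) = \<Union>?N"
    using openin_subset[OF oN] by blast
  then show "emeasure \<mu> (topspace X - measure_support X \<mu>) = 0" unfolding supp using null by simp
  show "measure_support X \<mu> \<subseteq> S" if "closedin X S" "emeasure \<mu> (topspace X - S) = 0"
    unfolding supp using that by blast
qed

end

theory Submission
  imports Defs
begin

text \<open>Both assertions say that \<open>\<C>(L)\<close> is a retract of \<open>\<C>(K)\<close> in the category of positive
  operators: there are positive \<open>T: \<C>(L) \<rightarrow> \<C>(K)\<close> and \<open>A: \<C>(K) \<rightarrow> \<C>(L)\<close>
  with \<open>A \<circ> T = id\<close>, \<open>A 1 = 1\<close> and \<open>T 1 \<le> 1\<close>. For the operator side this is the content of
  \<open>projection_from_section\<close> and \<open>section_from_projection\<close>; the key observation is that a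
  positive isometry onto a subspace has a positive inverse, so \<open>A = T\<inverse> \<circ> P\<close> is positive.

  Given \<open>T\<close> and \<open>A\<close>, each \<open>g \<mapsto> A g x\<close> is a state on \<open>\<C>(K)\<close> whose composition with
  \<open>T\<close> is the evaluation at \<open>x\<close>. Since evaluations are extreme among states, the state is
  concentrated on the points \<open>y\<close> for which \<open>f \<mapsto> T f y\<close> is itself the evaluation at \<open>x\<close>
  (\<open>section_concentrated\<close>). The points \<open>y\<close> obtained in this way for some \<open>x\<close> form
  \<open>F\<close>, the assignment of \<open>x\<close> to \<open>y\<close> is \<open>\<rho>\<close>, and the Riesz measures of the states are the values of \<open>\<phi>\<close>
  (\<open>representing_measures\<close>).

  Given \<open>F\<close>, \<open>\<rho>\<close> and \<open>\<phi>\<close>, the operator \<open>A\<close> integrates over the fibres of \<open>\<rho>\<close>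
  (\<open>averaging_operator\<close>). The operator \<open>T\<close> has to extend \<open>f \<circ> \<rho>\<close> from \<open>F\<close> to \<open>K\<close>
  linearly and positively. Metrizability of \<open>L\<close> is essential here: a simultaneous
  extension in the manner of Dugundji exists although \<open>K\<close> need not be metrizable, because the
  distances are measured in \<open>L\<close> (\<open>positive_extension_operator\<close>).\<close>

section \<open>Continuous functions on compact spaces\<close>

lemma cfun_continuous: "f \<in> cfun X \<Longrightarrow> continuous_map X euclideanreal f"
  by (simp add: cfun_def)

lemma cfun_outside: "f \<in> cfun X \<Longrightarrow> x \<notin> topspace X \<Longrightarrow> f x = 0"
  by (simp add: cfun_def)

lemma cfun_cut:
  assumes "continuous_map X euclideanreal f"
  shows "(\<lambda>x. if x \<in> topspace X then f x else 0) \<in> cfun X"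
  unfolding cfun_def using assms by (auto intro: continuous_map_eq)

lemma cfun_add: "f \<in> cfun X \<Longrightarrow> g \<in> cfun X \<Longrightarrow> (\<lambda>x. f x + g x) \<in> cfun X"
  unfolding cfun_def by (auto intro: continuous_intros)

lemma cfun_scale: "f \<in> cfun X \<Longrightarrow> (\<lambda>x. c * f x) \<in> cfun X"
  unfolding cfun_def by (auto intro: continuous_map_real_mult_left)

lemma cfun_abs: "f \<in> cfun X \<Longrightarrow> (\<lambda>x. \<bar>f x\<bar>) \<in> cfun X"
  unfolding cfun_def by (auto intro: continuous_intros)

lemma cfun_max: "f \<in> cfun X \<Longrightarrow> g \<in> cfun X \<Longrightarrow> (\<lambda>x. max (f x) (g x)) \<in> cfun X"
  unfolding cfun_def by (auto intro: continuous_intros)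

lemma cfun_sum:
  "(\<And>i. i \<in> I \<Longrightarrow> g i \<in> cfun X) \<Longrightarrow> finite I \<Longrightarrow> (\<lambda>x. \<Sum>i\<in>I. g i x) \<in> cfun X"
  unfolding cfun_def by (auto intro!: continuous_map_sum)

lemma cfun_zero: "(\<lambda>x. 0) \<in> cfun X"
  by (simp add: cfun_def)

lemma cfun_one: "indicator (topspace X) \<in> cfun X"
proof -
  have "indicator (topspace X) = (\<lambda>x. if x \<in> topspace X then 1 else 0 :: real)" by auto
  then show ?thesis using cfun_cut[of X "\<lambda>x. 1"] by simp
qed

lemma openin_less:
  assumes "continuous_map X euclideanreal f" "continuous_map X euclideanreal g"
  shows "openin X {x \<in> topspace X. f x < g x}"
proof -
  have "continuous_map X euclideanreal (\<lambda>x. g x - f x)"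
    using assms by (intro continuous_intros)
  then have "openin X {x \<in> topspace X. g x - f x \<in> {0<..}}"
    by (rule openin_continuous_map_preimage) auto
  then show ?thesis by simp
qed

lemma closedin_eq:
  assumes "continuous_map X euclideanreal f" "continuous_map X euclideanreal g"
  shows "closedin X {x \<in> topspace X. f x = g x}"
proof -
  have "continuous_map X euclideanreal (\<lambda>x. f x - g x)"
    using assms by (intro continuous_intros)
  then have "closedin X {x \<in> topspace X. f x - g x \<in> {0}}"
    by (rule closedin_continuous_map_preimage) auto
  then show ?thesis by simp
qed

lemma urysohn_bump:
  assumes "compact_space X" "Hausdorff_space X" "openin X U" "y \<in> U"
  obtains u where "u \<in> cfun X" "\<And>x. 0 \<le> u x" "\<And>x. u x \<le> indicator U x" "u y = 1"
proof -
  have "normal_space X"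
    using assms by (simp add: compact_Hausdorff_or_regular_imp_normal_space)
  moreover have yX: "y \<in> topspace X"
    using assms openin_subset by blast
  then have "closedin X {y}"
    using assms by (simp add: closedin_Hausdorff_singleton)
  moreover have "closedin X (topspace X - U)" using assms by blast
  ultimately obtain f where f: "continuous_map X (top_of_set {0..1::real}) f"
      "f ` (topspace X - U) \<subseteq> {0}" "f ` {y} \<subseteq> {1}"
    using Urysohn_lemma[of X "topspace X - U" "{y}" 0 1] assms(4)
    by (auto simp: disjnt_def)
  define u where "u = (\<lambda>x. if x \<in> topspace X then f x else 0)"
  have "continuous_map X euclideanreal f"
    using f by (simp add: continuous_map_in_subtopology)
  then have "u \<in> cfun X" unfolding u_def by (rule cfun_cut)
  moreover have rng: "f x \<in> {0..1}" if "x \<in> topspace X" for x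
    using f(1) that by (auto simp: continuous_map_in_subtopology)
  have "0 \<le> u x" "u x \<le> indicator U x" for x
    using rng f(2) by (auto simp: u_def indicator_def)
  moreover have "u y = 1" using f(3) yX by (simp add: u_def)
  ultimately show ?thesis using that by blast
qed

text \<open>Dini's theorem for an upward directed family in place of a monotone sequence: by compactness
  finitely many members cover, and directedness merges them into one. It replaces partitions of unity
  throughout, both in the subadditivity of the content below and in locating the support of a functional.\<close>

lemma dini_directed:
  assumes "compact_space X" and f: "continuous_map X euclideanreal f"
    and G: "\<And>g. g \<in> G \<Longrightarrow> continuous_map X euclideanreal g" "G \<noteq> {}"
    and dir: "\<And>g h. g \<in> G \<Longrightarrow> h \<in> G \<Longrightarrow> \<exists>k\<in>G. \<forall>x\<in>topspace X. g x \<le> k x \<and> h x \<le> k x"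
    and cover: "\<And>x. x \<in> topspace X \<Longrightarrow> \<exists>g\<in>G. f x < g x"
  obtains g where "g \<in> G" "\<And>x. x \<in> topspace X \<Longrightarrow> f x < g x"
proof -
  define U where "U g = {x \<in> topspace X. f x < g x}" for g
  have "\<exists>\<F>. finite \<F> \<and> \<F> \<subseteq> U ` G \<and> topspace X \<subseteq> \<Union>\<F>"
    using assms(1) unfolding compact_space_alt
  proof (rule allE[where x = "U ` G"])
    assume "Ball (U ` G) (openin X) \<and> topspace X \<subseteq> \<Union>(U ` G) \<longrightarrow> ?thesis"
    moreover have "Ball (U ` G) (openin X)"
      using openin_less[OF f] G by (auto simp: U_def)
    moreover have "topspace X \<subseteq> \<Union>(U ` G)" using cover by (auto simp: U_def)
    ultimately show ?thesis by blast
  qed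
  then obtain H where H: "finite H" "H \<subseteq> G" "topspace X \<subseteq> \<Union>(U ` H)"
    by (metis finite_subset_image)
  have "\<exists>k\<in>G. \<forall>g\<in>H. \<forall>x\<in>topspace X. g x \<le> k x"
    using H(1,2)
  proof (induction H)
    case empty
    then show ?case using G(2) by auto
  next
    case (insert g H)
    then obtain k where "k \<in> G" "\<forall>g\<in>H. \<forall>x\<in>topspace X. g x \<le> k x" by auto
    moreover obtain l where "l \<in> G" "\<forall>x\<in>topspace X. g x \<le> l x \<and> k x \<le> l x"
      using dir[of g k] insert \<open>k \<in> G\<close> by auto
    ultimately show ?case by (intro bexI[of _ l]) force+
  qed
  then obtain k where k: "k \<in> G" "\<And>g x. g \<in> H \<Longrightarrow> x \<in> topspace X \<Longrightarrow> g x \<le> k x" by blast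
  have "f x < k x" if "x \<in> topspace X" for x
    using H(3) that k(2) by (fastforce simp: U_def)
  with k(1) show ?thesis using that by blast
qed

section \<open>The Riesz representation of states on a compact Hausdorff space\<close>

text \<open>A state is a positive functional with value 1 at the constant function 1. Every state is integration
  against a regular Borel probability measure. The measure is obtained from its values on open sets,
  \<open>content U = sup {\<Lambda> f | 0 \<le> f \<le> 1\<^sub>U}\<close>, by outer regularity and Caratheodory's construction.
  The functions \<open>f\<close> are only required to vanish off \<open>U\<close>, not to have support inside
  \<open>U\<close>; an \<open>\<epsilon>\<close> of room in the estimates makes up for that.\<close>

locale cfun_state =
  fixes X :: "'a topology" and \<Lambda> :: "('a \<Rightarrow> real) \<Rightarrow> real"
  assumes compact: "compact_space X" and Hausdorff: "Hausdorff_space X"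
    and add: "f \<in> cfun X \<Longrightarrow> g \<in> cfun X \<Longrightarrow> \<Lambda> (\<lambda>x. f x + g x) = \<Lambda> f + \<Lambda> g"
    and scale: "f \<in> cfun X \<Longrightarrow> \<Lambda> (\<lambda>x. c * f x) = c * \<Lambda> f"
    and nonneg: "f \<in> cfun X \<Longrightarrow> (\<And>x. 0 \<le> f x) \<Longrightarrow> 0 \<le> \<Lambda> f"
    and one: "\<Lambda> (indicator (topspace X)) = 1"
begin

lemma zero: "\<Lambda> (\<lambda>x. 0) = 0"
  using scale[OF cfun_zero, of 0] by simp

lemma diff: "f \<in> cfun X \<Longrightarrow> g \<in> cfun X \<Longrightarrow> \<Lambda> (\<lambda>x. f x - g x) = \<Lambda> f - \<Lambda> g"
  using add[of f "\<lambda>x. (-1) * g x"] scale[of g "-1"] cfun_scale[of g X "-1"] by simp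

lemma mono:
  assumes "f \<in> cfun X" "g \<in> cfun X" "\<And>x. x \<in> topspace X \<Longrightarrow> f x \<le> g x"
  shows "\<Lambda> f \<le> \<Lambda> g"
proof -
  have "0 \<le> g x - f x" for x
    using assms cfun_outside[of f X x] cfun_outside[of g X x] by (cases "x \<in> topspace X") auto
  then have "0 \<le> \<Lambda> (\<lambda>x. g x - f x)"
    by (intro nonneg cfun_diff assms)
  then show ?thesis by (simp add: diff assms)
qed

lemma sum: "(\<And>i. i \<in> I \<Longrightarrow> g i \<in> cfun X) \<Longrightarrow> finite I \<Longrightarrow> \<Lambda> (\<lambda>x. \<Sum>i\<in>I. g i x) = (\<Sum>i\<in>I. \<Lambda> (g i))"
proof (induction I rule: infinite_finite_induct)
  case (insert i I)
  then show ?case using add[of "g i" "\<lambda>x. \<Sum>i\<in>I. g i x"] by (simp add: cfun_sum)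
qed (auto simp: zero)

definition subordinate :: "'a set \<Rightarrow> ('a \<Rightarrow> real) set" where
  "subordinate U = {f \<in> cfun X. \<forall>x. 0 \<le> f x \<and> f x \<le> indicator U x}"

definition content :: "'a set \<Rightarrow> ennreal" where
  "content U = (SUP f\<in>subordinate U. ennreal (\<Lambda> f))"

definition outer :: "'a set \<Rightarrow> ennreal" where
  "outer A = (INF U\<in>{U. openin X U \<and> A \<subseteq> U}. content U)"

lemma zero_subordinate: "(\<lambda>x. 0) \<in> subordinate U"
  by (simp add: subordinate_def cfun_zero)

lemma subordinateD:
  assumes "f \<in> subordinate U"
  shows "f \<in> cfun X" "0 \<le> f x" "f x \<le> indicator U x" "f x \<le> 1" "x \<notin> U \<Longrightarrow> f x = 0" "0 \<le> \<Lambda> f" "\<Lambda> f \<le> 1"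
proof -
  show f: "f \<in> cfun X" and 0: "0 \<le> f x" for x using assms by (auto simp: subordinate_def)
  show 1: "f x \<le> indicator U x" for x using assms by (auto simp: subordinate_def)
  then show 2: "f x \<le> 1" for x using indicator_le_1[of U x] by (meson order_trans)
  show "x \<notin> U \<Longrightarrow> f x = 0" using 0[of x] 1[of x] by simp
  show "0 \<le> \<Lambda> f" using f 0 by (rule nonneg)
  have "\<Lambda> f \<le> \<Lambda> (indicator (topspace X))"
    using f 2 by (intro mono cfun_one) (auto simp: indicator_def)
  then show "\<Lambda> f \<le> 1" by (simp add: one)
qed

lemma subordinate_mono: "U \<subseteq> V \<Longrightarrow> subordinate U \<subseteq> subordinate V"
  unfolding subordinate_def
proof safe
  fix f :: "'a \<Rightarrow> real" and x assume "U \<subseteq> V" "\<forall>x. 0 \<le> f x \<and> f x \<le> indicator U x"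
  then have "f x \<le> indicator U x" "indicator U x \<le> (indicator V x :: real)" by (auto simp: indicator_def)
  then show "f x \<le> indicator V x" by (rule order_trans)
qed auto

lemma content_upper: "f \<in> subordinate U \<Longrightarrow> ennreal (\<Lambda> f) \<le> content U"
  unfolding content_def by (rule SUP_upper)

lemma content_mono: "U \<subseteq> V \<Longrightarrow> content U \<le> content V"
  unfolding content_def by (rule SUP_subset_mono) (auto intro: subordinate_mono[THEN subsetD])

lemma content_le_1: "content U \<le> 1"
  unfolding content_def
proof (rule SUP_least)
  fix f assume "f \<in> subordinate U"
  then show "ennreal (\<Lambda> f) \<le> 1" using ennreal_leI[OF subordinateD(7)] by simp
qed

lemma content_empty: "content {} = 0"
proof -
  have "subordinate {} = {\<lambda>x. 0}"
    by (auto simp: zero_subordinate dest: subordinateD(5) intro!: ext)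
  then show ?thesis by (simp add: content_def zero)
qed

lemma content_topspace: "content (topspace X) = 1"
proof (rule antisym[OF content_le_1])
  have "indicator (topspace X) \<in> subordinate (topspace X)"
    by (simp add: subordinate_def cfun_one)
  then show "1 \<le> content (topspace X)" using content_upper[of "indicator (topspace X)"] by (simp add: one)
qed

text \<open>A function below the indicator of the union is, by Dini, below \<open>\<epsilon>\<close> plus a finite sum of functions
  subordinate to the single sets: those sums form a directed family because functions subordinate to
  one open set are closed under maxima.\<close>

lemma content_Union:
  assumes U: "\<And>i::nat. openin X (U i)"
  shows "content (\<Union>i. U i) \<le> (\<Sum>i. content (U i))"
  unfolding content_def[of "\<Union>i. U i"]
proof (rule SUP_least, rule ennreal_le_epsilon)
  fix f and e :: real
  assume f: "f \<in> subordinate (\<Union>i. U i)" and e: "0 < e"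
  \<comment> \<open>the indicator of the carrier is the constant 1 of \<open>cfun X\<close>; all members of \<open>G\<close> then lie in \<open>cfun X\<close>\<close>
  define G where "G = {\<lambda>x. e * indicator (topspace X) x + (\<Sum>i<N. g i x) | N g. \<forall>i. g i \<in> subordinate (U i)}"
  have G0: "(\<lambda>x. e * indicator (topspace X) x + (\<Sum>i<0. 0)) \<in> G"
    unfolding G_def using zero_subordinate by (intro CollectI exI[of _ 0] exI[of _ "\<lambda>i x. 0"]) simp
  obtain h where "h \<in> G" and h: "\<And>x. x \<in> topspace X \<Longrightarrow> f x < h x"
  proof (rule dini_directed[OF compact cfun_continuous[OF subordinateD(1)[OF f]], of G])
    show "continuous_map X euclideanreal g" if "g \<in> G" for g
    proof -
      obtain N g' where g: "g = (\<lambda>x. e * indicator (topspace X) x + (\<Sum>i<N. g' i x))" 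
          "\<And>i. g' i \<in> subordinate (U i)" using \<open>g \<in> G\<close> unfolding G_def by blast
      show ?thesis
        unfolding g(1)
        by (intro cfun_continuous cfun_add cfun_scale cfun_one cfun_sum subordinateD(1)[OF g(2)]) auto
    qed
    show "G \<noteq> {}" using G0 by blast
    show "\<exists>k\<in>G. \<forall>x\<in>topspace X. g x \<le> k x \<and> h x \<le> k x" if "g \<in> G" "h \<in> G" for g h
    proof -
      obtain N g' where g: "g = (\<lambda>x. e * indicator (topspace X) x + (\<Sum>i<N. g' i x))" 
          "\<And>i. g' i \<in> subordinate (U i)" using \<open>g \<in> G\<close> unfolding G_def by blast
      obtain M h' where h: "h = (\<lambda>x. e * indicator (topspace X) x + (\<Sum>i<M. h' i x))" 
          "\<And>i. h' i \<in> subordinate (U i)" using \<open>h \<in> G\<close> unfolding G_def by blast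
      define k' where "k' i x = max (g' i x) (h' i x)" for i x
      have k': "k' i \<in> subordinate (U i)" for i
        using g(2)[of i] h(2)[of i] unfolding k'_def[abs_def] subordinate_def
        by (auto intro: cfun_max simp: le_max_iff_disj)
      have "(\<Sum>i<N. g' i x) \<le> (\<Sum>i<max N M. k' i x)" for x
        by (rule order_trans[OF sum_mono[of _ _ "\<lambda>i. k' i x"] sum_mono2])
          (auto simp: k'_def subordinateD(2)[OF k', unfolded k'_def])
      moreover have "(\<Sum>i<M. h' i x) \<le> (\<Sum>i<max N M. k' i x)" for x
        by (rule order_trans[OF sum_mono[of _ _ "\<lambda>i. k' i x"] sum_mono2])
          (auto simp: k'_def subordinateD(2)[OF k', unfolded k'_def])
      moreover have "(\<lambda>x. e * indicator (topspace X) x + (\<Sum>i<max N M. k' i x)) \<in> G"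
        unfolding G_def using k' by blast
      ultimately show ?thesis unfolding g(1) h(1) by (intro bexI) auto
    qed
    show "\<exists>g\<in>G. f x < g x" if x: "x \<in> topspace X" for x
    proof (cases "x \<in> (\<Union>i. U i)")
      case True
      then obtain i where i: "x \<in> U i" by blast
      obtain u where u: "u \<in> cfun X" "\<And>x. 0 \<le> u x" "\<And>x. u x \<le> indicator (U i) x" "u x = 1"
        using urysohn_bump[OF compact Hausdorff U i] by metis
      define g where "g = (\<lambda>j. if j = i then u else (\<lambda>x. 0))"
      have g: "g j \<in> subordinate (U j)" for j
        using u zero_subordinate by (auto simp: g_def subordinate_def)
      have gG: "(\<lambda>x. e * indicator (topspace X) x + (\<Sum>j<Suc i. g j x)) \<in> G"
        unfolding G_def using g by blast
      have "(\<Sum>j<Suc i. g j x) = 1" using u(4) by (simp add: g_def)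
      then have "f x < e * indicator (topspace X) x + (\<Sum>j<Suc i. g j x)"
        using x e subordinateD(4)[OF f, of x] by simp
      then show ?thesis by (rule bexI[where P = "\<lambda>g. f x < g x", OF _ gG])
    next
      case False
      then have "f x = 0" using subordinateD(5)[OF f] by blast
      then show ?thesis using e x by (intro bexI[OF _ G0]) simp
    qed
  qed (use that in blast)
  then obtain N g where hdef: "h = (\<lambda>x. e * indicator (topspace X) x + (\<Sum>i<N. g i x))"
     and g: "\<And>i. g i \<in> subordinate (U i)" unfolding G_def by blast
  note gc = subordinateD(1)[OF g]
  have "\<Lambda> f \<le> \<Lambda> h"
    unfolding hdef
    by (intro mono cfun_add cfun_scale cfun_one cfun_sum gc subordinateD(1)[OF f])
       (use h in \<open>auto simp: hdef less_imp_le\<close>)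
  also have "\<Lambda> h = e + (\<Sum>i<N. \<Lambda> (g i))"
    unfolding hdef by (simp add: add scale one sum cfun_scale cfun_one cfun_sum gc)
  finally have "ennreal (\<Lambda> f) \<le> ennreal (e + (\<Sum>i<N. \<Lambda> (g i)))" by (rule ennreal_leI)
  also have "\<dots> = (\<Sum>i<N. ennreal (\<Lambda> (g i))) + ennreal e"
    using e subordinateD(6)[OF g] by (simp add: sum_nonneg ennreal_plus add.commute)
  also have "(\<Sum>i<N. ennreal (\<Lambda> (g i))) \<le> (\<Sum>i<N. content (U i))"
    by (intro sum_mono content_upper g)
  also have "\<dots> \<le> (\<Sum>i. content (U i))"
    by (intro sum_le_suminf) auto
  finally show "ennreal (\<Lambda> f) \<le> (\<Sum>i. content (U i)) + ennreal e"
    by (simp add: add_right_mono)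
qed

lemma outer_open: "openin X U \<Longrightarrow> outer U = content U"
  unfolding outer_def by (intro antisym INF_lower INF_greatest) (auto intro: content_mono)

lemma outer_mono: "A \<subseteq> B \<Longrightarrow> outer A \<le> outer B"
  unfolding outer_def by (intro INF_superset_mono) auto

lemma outer_close:
  assumes "A \<subseteq> topspace X" "0 < (e::real)"
  obtains U where "openin X U" "A \<subseteq> U" "content U \<le> outer A + ennreal e"
proof -
  have "outer A \<le> content (topspace X)"
    unfolding outer_def using assms(1) by (intro INF_lower) auto
  then have "outer A \<noteq> \<infinity>" by (auto simp: content_topspace top_unique)
  then have "outer A < outer A + ennreal e"
    using assms by (simp add: ennreal_add_left_cancel_less)
  then show ?thesis
    using that unfolding outer_def[of A] INF_less_iff by (auto intro: less_imp_le)
qed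

lemma outer_measure_space_outer: "outer_measure_space (Pow (topspace X)) outer"
  unfolding outer_measure_space_def
proof (intro conjI)
  show "positive (Pow (topspace X)) outer"
    by (simp add: positive_def outer_open content_empty)
  show "increasing (Pow (topspace X)) outer"
    by (simp add: increasing_def outer_mono)
  show "countably_subadditive (Pow (topspace X)) outer"
    unfolding countably_subadditive_def
  proof (intro allI impI, rule ennreal_le_epsilon)
    fix A :: "nat \<Rightarrow> 'a set" and e :: real
    assume A: "range A \<subseteq> Pow (topspace X)" and e: "0 < e"
    have "\<exists>U. openin X U \<and> A i \<subseteq> U \<and> content U \<le> outer (A i) + ennreal (e * (1/2) ^ Suc i)" for i
    proof -
      have "A i \<subseteq> topspace X" "0 < e * (1/2) ^ Suc i" using A e by auto
      then show ?thesis by (rule outer_close) blast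
    qed
    then obtain U where U: "\<And>i. openin X (U i)" "\<And>i. A i \<subseteq> U i"
        "\<And>i. content (U i) \<le> outer (A i) + ennreal (e * (1/2) ^ Suc i)" by metis
    have "outer (\<Union>i. A i) \<le> outer (\<Union>i. U i)" using U(2) by (intro outer_mono) blast
    also have "\<dots> = content (\<Union>i. U i)" using U(1) by (intro outer_open) auto
    also have "\<dots> \<le> (\<Sum>i. content (U i))" using U(1) by (rule content_Union)
    also have "\<dots> \<le> (\<Sum>i. outer (A i) + ennreal (e * (1/2) ^ Suc i))"
      using U(3) by (intro suminf_le) auto
    also have "\<dots> = (\<Sum>i. outer (A i)) + (\<Sum>i. ennreal (e * (1/2) ^ Suc i))"
      by (rule suminf_add[symmetric]) auto
    also have "(\<Sum>i. ennreal (e * (1/2) ^ Suc i)) = ennreal e"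
    proof -
      have "(\<lambda>i. e * (1/2) ^ Suc i) sums e"
        using sums_mult[OF power_half_series, of e] by simp
      then show ?thesis using e by (intro suminf_ennreal_eq) auto
    qed
    finally show "outer (\<Union>i. A i) \<le> (\<Sum>i. outer (A i)) + ennreal e" .
  qed
qed

text \<open>The Caratheodory condition for open sets. Take \<open>g\<close> almost optimal for \<open>U \<inter> V\<close>. The part of
  \<open>V\<close> where \<open>g < \<epsilon>\<close> is an open neighbourhood of \<open>V - U\<close>, and a function \<open>h\<close> subordinate to it
  can be added to \<open>g\<close> without exceeding \<open>1 + \<epsilon>\<close>, so that \<open>(g + h) / (1 + \<epsilon>)\<close> competes in
  the content of \<open>V\<close>.\<close>

lemma content_split:
  assumes U: "openin X U" and V: "openin X V"
  shows "content (U \<inter> V) + outer (V - U) \<le> content V"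
proof -
  have *: "ennreal (\<Lambda> g) + outer (V - U) \<le> content V" if g: "g \<in> subordinate (U \<inter> V)" for g
  proof (rule ennreal_le_epsilon)
    fix e :: real assume e: "0 < e"
    define W where "W = V \<inter> {x \<in> topspace X. g x < e}"
    have "openin X W"
      unfolding W_def using V cfun_continuous[OF subordinateD(1)[OF g]]
      by (intro openin_Int openin_less) auto
    moreover have "V - U \<subseteq> W"
      using subordinateD(5)[OF g] e openin_subset[OF V] by (auto simp: W_def)
    ultimately have "outer (V - U) \<le> content W"
      unfolding outer_def by (intro INF_lower) auto
    then have "ennreal (\<Lambda> g) + outer (V - U) \<le> ennreal (\<Lambda> g) + content W"
      by (rule add_left_mono)
    also have "\<dots> = (SUP h\<in>subordinate W. ennreal (\<Lambda> g) + ennreal (\<Lambda> h))"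
      unfolding content_def using zero_subordinate by (intro ennreal_SUP_add_right) auto
    also have "\<dots> \<le> content V + ennreal e"
    proof (rule SUP_least)
      fix h assume h: "h \<in> subordinate W"
      define k where "k = (\<lambda>x. (1 / (1 + e)) * (g x + h x))"
      have gh: "(\<lambda>x. g x + h x) \<in> cfun X"
        using subordinateD(1)[OF g] subordinateD(1)[OF h] by (rule cfun_add)
      have "g x + h x \<le> (1 + e) * indicator V x" for x
        using subordinateD(2,4,5)[OF g, of x] subordinateD(2,4,5)[OF h, of x] e
        by (cases "x \<in> V"; cases "x \<in> W") (auto simp: W_def)
      moreover have "k \<in> cfun X" unfolding k_def by (rule cfun_scale[OF gh])
      ultimately have "k \<in> subordinate V"
        using e subordinateD(2)[OF g] subordinateD(2)[OF h]
        by (auto simp: subordinate_def k_def field_simps)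
      note k = content_upper[OF this] subordinateD(6,7)[OF this]
      have "\<Lambda> k = (1 / (1 + e)) * (\<Lambda> g + \<Lambda> h)"
        unfolding k_def scale[OF gh] by (simp add: add subordinateD(1)[OF g] subordinateD(1)[OF h])
      then have "\<Lambda> g + \<Lambda> h = \<Lambda> k + e * \<Lambda> k" using e by (simp add: field_simps)
      also have "\<dots> \<le> \<Lambda> k + e" using k(3) e by simp
      finally have "ennreal (\<Lambda> g + \<Lambda> h) \<le> ennreal (\<Lambda> k + e)" by (rule ennreal_leI)
      then have "ennreal (\<Lambda> g) + ennreal (\<Lambda> h) \<le> ennreal (\<Lambda> k) + ennreal e"
        using e subordinateD(6)[OF g] subordinateD(6)[OF h] k(2) by (simp add: ennreal_plus)
      also have "\<dots> \<le> content V + ennreal e" using k(1) by (rule add_right_mono)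
      finally show "ennreal (\<Lambda> g) + ennreal (\<Lambda> h) \<le> content V + ennreal e" .
    qed
    finally show "ennreal (\<Lambda> g) + outer (V - U) \<le> content V + ennreal e" .
  qed
  have "content (U \<inter> V) + outer (V - U) = (SUP g\<in>subordinate (U \<inter> V). ennreal (\<Lambda> g) + outer (V - U))"
    unfolding content_def using zero_subordinate by (intro ennreal_SUP_add_left[symmetric]) auto
  also have "\<dots> \<le> content V" using * by (rule SUP_least)
  finally show ?thesis .
qed

lemma open_in_lambda_system:
  assumes U: "openin X U"
  shows "U \<in> lambda_system (topspace X) (Pow (topspace X)) outer"
  unfolding lambda_system_def
proof (intro CollectI conjI ballI)
  show "U \<in> Pow (topspace X)" using openin_subset[OF U] by simp
  fix A assume A: "A \<in> Pow (topspace X)"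
  have "subadditive (Pow (topspace X)) outer"
    using outer_measure_space_outer unfolding outer_measure_space_def
    by (intro ring_of_sets.countably_subadditive_subadditive[OF ring_of_sets_Pow]) auto
  then have "outer ((U \<inter> A) \<union> ((topspace X - U) \<inter> A)) \<le> outer (U \<inter> A) + outer ((topspace X - U) \<inter> A)"
    using A by (intro subadditiveD) auto
  moreover have "(U \<inter> A) \<union> ((topspace X - U) \<inter> A) = A" using A by auto
  moreover have "outer (U \<inter> A) + outer ((topspace X - U) \<inter> A) \<le> content V"
    if V: "openin X V" "A \<subseteq> V" for V
  proof -
    have "outer (U \<inter> A) \<le> outer (U \<inter> V)" using V by (intro outer_mono) auto
    also have "\<dots> = content (U \<inter> V)" using U V by (intro outer_open) auto
    finally have "outer (U \<inter> A) + outer ((topspace X - U) \<inter> A) \<le> content (U \<inter> V) + outer (V - U)"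
      using V by (intro add_mono outer_mono) auto
    then show ?thesis using content_split[OF U V(1)] by (rule order_trans)
  qed
  then have "outer (U \<inter> A) + outer ((topspace X - U) \<inter> A) \<le> outer A"
    unfolding outer_def[of A] by (intro INF_greatest) auto
  ultimately show "outer (U \<inter> A) + outer ((topspace X - U) \<inter> A) = outer A"
    by (metis antisym)
qed

definition riesz_measure :: "'a measure" where
  "riesz_measure = measure_of (topspace X) {U. openin X U} outer"

lemma opens_Pow: "{U. openin X U} \<subseteq> Pow (topspace X)"
  by (auto dest: openin_subset)

lemma space_riesz: "space riesz_measure = topspace X"
  unfolding riesz_measure_def by (rule space_measure_of[OF opens_Pow])

lemma sets_riesz: "sets riesz_measure = sigma_sets (topspace X) {U. openin X U}"
  unfolding riesz_measure_def by (rule sets_measure_of[OF opens_Pow])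

lemma emeasure_riesz:
  assumes "A \<in> sets riesz_measure"
  shows "emeasure riesz_measure A = outer A"
proof -
  let ?L = "lambda_system (topspace X) (Pow (topspace X)) outer"
  have L: "measure_space (topspace X) ?L outer"
    by (rule sigma_algebra.caratheodory_lemma[OF sigma_algebra_Pow outer_measure_space_outer])
  then interpret L: sigma_algebra "topspace X" ?L by (simp add: measure_space_def)
  have "sigma_sets (topspace X) {U. openin X U} \<subseteq> ?L"
    using open_in_lambda_system by (intro L.sigma_sets_subset) auto
  with L have "measure_space (topspace X) (sigma_sets (topspace X) {U. openin X U}) outer"
    by (rule measure_down[OF _ sigma_algebra_sigma_sets[OF opens_Pow]])
  then show ?thesis
    using assms unfolding sets_riesz unfolding riesz_measure_def
    by (simp add: emeasure_measure_of_conv)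
qed

lemma emeasure_riesz_open:
  assumes "openin X U"
  shows "emeasure riesz_measure U = content U"
proof -
  have "U \<in> sets riesz_measure" unfolding sets_riesz using assms by auto
  then show ?thesis using assms by (simp add: emeasure_riesz outer_open)
qed

lemma prob_space_riesz: "prob_space riesz_measure"
  by (rule prob_spaceI) (simp add: space_riesz emeasure_riesz_open content_topspace)

lemma riesz_outer_regular:
  assumes "A \<in> sets riesz_measure" "0 < (e::real)"
  obtains U where "openin X U" "A \<subseteq> U" "measure riesz_measure U \<le> measure riesz_measure A + e"
proof -
  interpret prob_space riesz_measure by (rule prob_space_riesz)
  have "A \<subseteq> topspace X" using sets.sets_into_space[OF assms(1)] by (simp add: space_riesz)
  then obtain U where U: "openin X U" "A \<subseteq> U" "content U \<le> outer A + ennreal e"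
    using outer_close assms(2) by metis
  have "ennreal (measure riesz_measure U) \<le> ennreal (measure riesz_measure A) + ennreal e"
    using U(3) emeasure_riesz_open[OF U(1)] emeasure_riesz[OF assms(1)] by (simp flip: emeasure_eq_measure)
  then have "measure riesz_measure U \<le> measure riesz_measure A + e"
    using assms(2) by (simp flip: ennreal_plus)
  with U show ?thesis using that by blast
qed

text \<open>Outer regularity holds by construction; applied to complements it gives inner regularity, since the
  complements of open sets are compact.\<close>

lemma regular_riesz: "regular_measure X riesz_measure"
  unfolding regular_measure_def
proof (intro ballI conjI)
  interpret prob_space riesz_measure by (rule prob_space_riesz)
  fix A assume A: "A \<in> sets riesz_measure"
  let ?C = "{C. C \<in> sets riesz_measure \<and> compactin X C \<and> C \<subseteq> A}"
  show "emeasure riesz_measure A = (INF U\<in>{U. openin X U \<and> A \<subseteq> U}. emeasure riesz_measure U)"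
    unfolding emeasure_riesz[OF A] outer_def by (intro INF_cong refl) (simp add: emeasure_riesz_open)
  show "emeasure riesz_measure A = (SUP C\<in>?C. emeasure riesz_measure C)"
  proof (rule antisym)
    show "emeasure riesz_measure A \<le> (SUP C\<in>?C. emeasure riesz_measure C)"
    proof (rule ennreal_le_epsilon)
      fix e :: real assume e: "0 < e"
      have "topspace X - A \<in> sets riesz_measure"
        using sets.compl_sets[OF A] by (simp add: space_riesz)
      then obtain U where U: "openin X U" "topspace X - A \<subseteq> U"
          "measure riesz_measure U \<le> measure riesz_measure (topspace X - A) + e"
        using riesz_outer_regular e by metis
      have Us: "U \<in> sets riesz_measure" unfolding sets_riesz using U(1) by auto
      let ?K = "topspace X - U"
      have K: "?K \<in> ?C"
        using U(1,2) closedin_compact_space[OF compact, of ?K] sets.compl_sets[OF Us]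
        by (auto simp: space_riesz)
      have "measure riesz_measure A \<le> measure riesz_measure ?K + e"
        using U(3) prob_compl[OF A] prob_compl[OF Us] by (simp add: space_riesz)
      then have "emeasure riesz_measure A \<le> emeasure riesz_measure ?K + ennreal e"
        using e by (simp add: emeasure_eq_measure flip: ennreal_plus)
      also have "emeasure riesz_measure ?K \<le> (SUP C\<in>?C. emeasure riesz_measure C)"
        using K by (rule SUP_upper)
      finally show "emeasure riesz_measure A \<le> (SUP C\<in>?C. emeasure riesz_measure C) + ennreal e"
        by (simp add: add_right_mono)
    qed
    show "(SUP C\<in>?C. emeasure riesz_measure C) \<le> emeasure riesz_measure A"
      using A by (intro SUP_least emeasure_mono) auto
  qed
qed

lemma riesz_regular_prob: "riesz_measure \<in> regular_prob X"
  unfolding regular_prob_def borel_on_def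
  using prob_space_riesz regular_riesz by (simp add: sets_riesz sets_measure_of[OF opens_Pow])

end

lemma regular_prob_sets:
  assumes "\<mu> \<in> regular_prob X"
  shows "sets \<mu> = sigma_sets (topspace X) {U. openin X U}" "space \<mu> = topspace X" "prob_space \<mu>"
proof -
  have "{U. openin X U} \<subseteq> Pow (topspace X)" by (auto dest: openin_subset)
  moreover have "sets \<mu> = sets (borel_on X)" using assms by (simp add: regular_prob_def)
  ultimately show "sets \<mu> = sigma_sets (topspace X) {U. openin X U}" "space \<mu> = topspace X"
    using sets_eq_imp_space_eq[of \<mu> "borel_on X"] by (simp_all add: borel_on_def)
  show "prob_space \<mu>" using assms by (simp add: regular_prob_def)
qed

lemma cfun_measurable:
  assumes "\<mu> \<in> regular_prob X" "f \<in> cfun X"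
  shows "f \<in> borel_measurable \<mu>"
proof (rule borel_measurableI)
  fix S :: "real set" assume "open S"
  then have "openin X {x \<in> topspace X. f x \<in> S}"
    using cfun_continuous[OF assms(2)] by (intro openin_continuous_map_preimage) auto
  moreover have "f -` S \<inter> space \<mu> = {x \<in> topspace X. f x \<in> S}"
    using assms by (auto simp: regular_prob_sets)
  ultimately show "f -` S \<inter> space \<mu> \<in> sets \<mu>"
    using assms by (auto simp: regular_prob_sets)
qed

lemma cfun_integrable:
  assumes "compact_space X" "\<mu> \<in> regular_prob X" "f \<in> cfun X"
  shows "integrable \<mu> f"
proof -
  interpret prob_space \<mu> using assms(2) by (rule regular_prob_sets)
  show ?thesis
    using sup_norm_upper[OF assms(1,3)] cfun_measurable[OF assms(2,3)]
    by (intro integrable_const_bound[where B = "sup_norm X f"]) auto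
qed

lemma sum_unit_slices:
  fixes t :: real
  assumes "0 \<le> t"
  shows "(\<Sum>k<n. max 0 (min 1 (t - real k))) = min t (real n)"
  by (induction n) (use assms in \<open>auto simp: min_def max_def\<close>)

context cfun_state begin

text \<open>The layer cake argument: \<open>N f\<close> is the sum of the \<open>N\<close> slices \<open>c\<^sub>k\<close>, the part of
  \<open>N f\<close> between the heights \<open>k\<close> and \<open>k + 1\<close>. With \<open>U\<^sub>k = {N f > k}\<close> each slice
  lies between the indicators of \<open>U\<^sub>k\<^sub>+\<^sub>1\<close> and \<open>U\<^sub>k\<close>; the upper bound
  controls \<open>\<Lambda>\<close>, the lower one the integral, and shifting the index costs at most one summand,
  that is \<open>1 / N\<close> after division.\<close>

lemma le_integral_riesz_unit:
  assumes f: "f \<in> cfun X" and f01: "\<And>x. 0 \<le> f x" "\<And>x. f x \<le> 1"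
  shows "\<Lambda> f \<le> (\<integral>x. f x \<partial>riesz_measure)"
proof -
  interpret prob_space riesz_measure by (rule prob_space_riesz)
  note int = cfun_integrable[OF compact riesz_regular_prob]
  have "\<Lambda> f \<le> (\<integral>x. f x \<partial>riesz_measure) + 1 / real N" if N: "0 < N" for N :: nat
  proof -
    define U where "U k = {x \<in> topspace X. real k < real N * f x}" for k
    define c where "c k x = max 0 (min 1 (real N * f x - real k))" for k x
    have U: "openin X (U k)" for k
      unfolding U_def using cfun_continuous[OF f]
      by (intro openin_less continuous_map_real_mult_left) auto
    have c_sub: "c k \<in> subordinate (U k)" for k
    proof -
      have "c k \<in> cfun X"
        using cfun_continuous[OF f] cfun_outside[OF f] unfolding c_def[abs_def] cfun_def
        by (auto intro!: continuous_intros continuous_map_real_mult_left)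
      then show ?thesis
        using cfun_outside[OF f] unfolding subordinate_def by (auto simp: c_def U_def indicator_def)
    qed
    have sum_c: "(\<Sum>k<N. c k x) = real N * f x" for x
      unfolding c_def using f01[of x] N by (subst sum_unit_slices) (auto simp: min_def)
    have U_sets: "U k \<in> sets riesz_measure" for k unfolding sets_riesz using U by auto
    have upper: "\<Lambda> (c k) \<le> measure riesz_measure (U k)" for k
      using content_upper[OF c_sub, of k] emeasure_riesz_open[OF U, of k]
      by (intro ennreal_le_iff[OF measure_nonneg, THEN iffD1]) (simp add: emeasure_eq_measure)
    have lower: "measure riesz_measure (U (Suc k)) \<le> (\<integral>x. c k x \<partial>riesz_measure)" for k
    proof -
      have "measure riesz_measure (U (Suc k)) = (\<integral>x. indicator (U (Suc k)) x \<partial>riesz_measure)"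
        using U_sets by simp
      also have "\<dots> \<le> (\<integral>x. c k x \<partial>riesz_measure)"
      proof (rule integral_mono[OF _ int[OF subordinateD(1)[OF c_sub]]])
        show "integrable riesz_measure (indicator (U (Suc k)) :: 'a \<Rightarrow> real)"
          using U_sets by (simp add: emeasure_eq_measure less_top)
      qed (auto simp: c_def U_def indicator_def)
      finally show ?thesis .
    qed
    have "real N * \<Lambda> f = \<Lambda> (\<lambda>x. \<Sum>k<N. c k x)" by (simp add: sum_c scale[OF f])
    also have "\<dots> = (\<Sum>k<N. \<Lambda> (c k))" by (intro sum subordinateD(1)[OF c_sub]) auto
    also have "\<dots> \<le> (\<Sum>k<N. measure riesz_measure (U k))" by (intro sum_mono upper)
    also have "\<dots> \<le> (\<Sum>k<Suc N. measure riesz_measure (U k))" by simp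
    also have "\<dots> = measure riesz_measure (U 0) + (\<Sum>k<N. measure riesz_measure (U (Suc k)))"
      by (rule sum.lessThan_Suc_shift)
    also have "\<dots> \<le> 1 + (\<Sum>k<N. \<integral>x. c k x \<partial>riesz_measure)"
      by (intro add_mono sum_mono lower) simp
    also have "(\<Sum>k<N. \<integral>x. c k x \<partial>riesz_measure) = (\<integral>x. (\<Sum>k<N. c k x) \<partial>riesz_measure)"
      by (intro Bochner_Integration.integral_sum[symmetric] int subordinateD(1)[OF c_sub])
    also have "\<dots> = real N * (\<integral>x. f x \<partial>riesz_measure)" by (simp add: sum_c)
    finally show ?thesis using N by (simp add: field_simps)
  qed
  then have "\<Lambda> f - (\<integral>x. f x \<partial>riesz_measure) \<le> 1 / real (Suc n)" for n
    by (metis add.commute diff_le_eq zero_less_Suc)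
  then have "\<Lambda> f - (\<integral>x. f x \<partial>riesz_measure) \<le> 0"
    by (intro LIMSEQ_le_const[OF LIMSEQ_Suc[OF lim_1_over_n]]) auto
  then show ?thesis by simp
qed

text \<open>For \<open>0 \<le> f \<le> 1\<close> the inequality of the previous lemma for \<open>1 - f\<close> is the reverse inequality for
  \<open>f\<close>. An affine change of the values reduces the general case to this one.\<close>

theorem riesz_representation:
  assumes f: "f \<in> cfun X"
  shows "(\<integral>x. f x \<partial>riesz_measure) = \<Lambda> f"
proof -
  interpret prob_space riesz_measure by (rule prob_space_riesz)
  note int = cfun_integrable[OF compact riesz_regular_prob]
  let ?one = "indicator (topspace X) :: 'a \<Rightarrow> real"
  have int_one: "(\<integral>x. ?one x \<partial>riesz_measure) = 1"
    using prob_space by (simp add: space_riesz)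
  have unit: "(\<integral>x. g x \<partial>riesz_measure) = \<Lambda> g"
    if g: "g \<in> cfun X" "\<And>x. 0 \<le> g x" "\<And>x. g x \<le> 1" for g
  proof (rule antisym)
    have "\<Lambda> (\<lambda>x. ?one x - g x) \<le> (\<integral>x. ?one x - g x \<partial>riesz_measure)"
      using g(2,3) cfun_outside[OF g(1)]
      by (intro le_integral_riesz_unit cfun_diff cfun_one g(1)) (auto simp: indicator_def)
    then show "(\<integral>x. g x \<partial>riesz_measure) \<le> \<Lambda> g"
      unfolding diff[OF cfun_one g(1)] one Bochner_Integration.integral_diff[OF int[OF cfun_one] int[OF g(1)]]
        int_one by simp
  qed (rule le_integral_riesz_unit[OF g])
  define M where "M = sup_norm X f + 1"
  have M: "0 < M"
    using sup_norm_upper[OF compact f, of undefined] unfolding M_def by linarith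
  have fle: "\<bar>f x\<bar> \<le> M" for x
    using sup_norm_upper[OF compact f, of x] unfolding M_def by linarith
  let ?g = "\<lambda>x. (1 / (2 * M)) * (f x + M * ?one x)"
  have fM: "(\<lambda>x. f x + M * ?one x) \<in> cfun X"
    by (intro cfun_add f cfun_scale cfun_one)
  have "(\<integral>x. ?g x \<partial>riesz_measure) = \<Lambda> ?g"
  proof (rule unit)
    show "?g \<in> cfun X" by (rule cfun_scale[OF fM])
    fix x
    have "0 \<le> f x + M * ?one x" "f x + M * ?one x \<le> 2 * M"
      using M fle[of x] cfun_outside[OF f, of x] by (auto simp: indicator_def)
    then show "0 \<le> ?g x" "?g x \<le> 1" using M by simp_all
  qed
  also have "\<Lambda> ?g = (1 / (2 * M)) * (\<Lambda> f + M)"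
    unfolding scale[OF fM] by (simp add: add scale f cfun_scale cfun_one one)
  also have "(\<integral>x. ?g x \<partial>riesz_measure) = (1 / (2 * M)) * ((\<integral>x. f x \<partial>riesz_measure) + M)"
    unfolding integral_mult_right_zero Bochner_Integration.integral_add[OF int[OF f] int[OF cfun_scale[OF cfun_one]]]
      int_one by simp
  finally show ?thesis using M by simp
qed

end

section \<open>A positive extension operator\<close>

lemma continuous_map_real_nbhd:
  "continuous_map X euclideanreal f \<longleftrightarrow>
     (\<forall>x\<in>topspace X. \<forall>e>0. \<exists>U. openin X U \<and> x \<in> U \<and> (\<forall>y\<in>U. \<bar>f y - f x\<bar> < e))"
  using Met_TC.continuous_map_to_metric[of X f] by (simp add: dist_real_def abs_minus_commute)

text \<open>The superlevel sets of the supremum are unions of open slices if they are strict; otherwise they are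
  projections of closed sets along the compact factor, hence closed.\<close>

lemma continuous_map_SUP_compact:
  fixes G :: "'a \<Rightarrow> 'b \<Rightarrow> real"
  assumes Z: "compact_space Z" "topspace Z \<noteq> {}"
    and G: "continuous_map (prod_topology X Z) euclideanreal (\<lambda>(x,z). G x z)"
  shows "x \<in> topspace X \<Longrightarrow> \<exists>z\<in>topspace Z. (SUP z\<in>topspace Z. G x z) = G x z"
    and "x \<in> topspace X \<Longrightarrow> z \<in> topspace Z \<Longrightarrow> G x z \<le> (SUP z\<in>topspace Z. G x z)"
    and "continuous_map X euclideanreal (\<lambda>x. SUP z\<in>topspace Z. G x z)"
proof -
  have slice1: "continuous_map X euclideanreal (\<lambda>x. G x z)" if "z \<in> topspace Z" for z
    using continuous_map_compose[OF _ G, of X "\<lambda>x. (x, z)"] that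
    by (simp add: continuous_map_paired o_def)
  have slice2: "continuous_map Z euclideanreal (\<lambda>z. G x z)" if "x \<in> topspace X" for x
    using continuous_map_compose[OF _ G, of Z "\<lambda>z. (x, z)"] that
    by (simp add: continuous_map_paired o_def)
  have max: "\<exists>z\<in>topspace Z. \<forall>w\<in>topspace Z. G x w \<le> G x z" if "x \<in> topspace X" for x
  proof -
    have "compactin euclideanreal ((\<lambda>z. G x z) ` topspace Z)"
      using Z(1) slice2[OF that] unfolding compact_space_def by (rule image_compactin)
    then show ?thesis
      using compact_attains_sup[of "(\<lambda>z. G x z) ` topspace Z"] Z(2)
      by (auto simp: compactin_euclidean_iff)
  qed
  have bdd: "bdd_above ((\<lambda>z. G x z) ` topspace Z)" if "x \<in> topspace X" for x
    using max[OF that] by (auto intro: bdd_aboveI2)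
  show upper: "G x z \<le> (SUP z\<in>topspace Z. G x z)" if "x \<in> topspace X" "z \<in> topspace Z" for x z
    using that bdd by (intro cSUP_upper) auto
  show attained: "\<exists>z\<in>topspace Z. (SUP z\<in>topspace Z. G x z) = G x z" if x: "x \<in> topspace X" for x
  proof -
    obtain z where z: "z \<in> topspace Z" "\<forall>w\<in>topspace Z. G x w \<le> G x z" using max[OF x] by blast
    then have "(SUP z\<in>topspace Z. G x z) = G x z"
      using Z(2) upper[OF x] by (intro antisym cSUP_least) auto
    with z show ?thesis by blast
  qed
  show "continuous_map X euclideanreal (\<lambda>x. SUP z\<in>topspace Z. G x z)"
    unfolding continuous_map_upper_lower_semicontinuous_lt
  proof (intro conjI allI)
    fix a :: real
    have "{x \<in> topspace X. a < (SUP z\<in>topspace Z. G x z)}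
      = (\<Union>z\<in>topspace Z. {x \<in> topspace X. a < G x z})"
      using attained upper by (fastforce intro: less_le_trans)
    moreover have "openin X {x \<in> topspace X. a < G x z}" if "z \<in> topspace Z" for z
      using slice1[OF that] by (intro openin_less) auto
    ultimately show "openin X {x \<in> topspace X. a < (SUP z\<in>topspace Z. G x z)}"
      by auto
    let ?A = "{p \<in> topspace (prod_topology X Z). (case p of (x, z) \<Rightarrow> G x z) \<in> {a..}}"
    have "closedin (prod_topology X Z) ?A"
      by (rule closedin_continuous_map_preimage[OF G]) auto
    then have "closedin X (fst ` ?A)"
      using closed_map_fst[OF Z(1)] unfolding closed_map_def by blast
    moreover have "{x \<in> topspace X. (SUP z\<in>topspace Z. G x z) < a} = topspace X - fst ` ?A"
    proof (intro set_eqI iffI)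
      fix x assume "x \<in> {x \<in> topspace X. (SUP z\<in>topspace Z. G x z) < a}"
      then show "x \<in> topspace X - fst ` ?A" using upper by (fastforce simp: not_le[symmetric])
    next
      fix x assume x: "x \<in> topspace X - fst ` ?A"
      then obtain z where z: "z \<in> topspace Z" "(SUP z\<in>topspace Z. G x z) = G x z"
        using attained by blast
      then have "\<not> a \<le> G x z" using x by (auto simp: image_iff)
      then show "x \<in> {x \<in> topspace X. (SUP z\<in>topspace Z. G x z) < a}" using x z by auto
    qed
    ultimately show "openin X {x \<in> topspace X. (SUP z\<in>topspace Z. G x z) < a}" by auto
  qed
qed

lemma continuous_map_suminf:
  fixes a :: "nat \<Rightarrow> 'a \<Rightarrow> real"
  assumes a: "\<And>n. continuous_map X euclideanreal (a n)"
    and b: "\<And>n x. x \<in> topspace X \<Longrightarrow> \<bar>a n x\<bar> \<le> b n" "summable b"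
  shows "continuous_map X euclideanreal (\<lambda>x. \<Sum>n. a n x)"
proof -
  have "uniform_limit (topspace X) (\<lambda>N x. \<Sum>n<N. a n x) (\<lambda>x. \<Sum>n. a n x) sequentially"
    using b by (intro Weierstrass_m_test) auto
  then have "continuous_map X Met_TC.mtopology (\<lambda>x. \<Sum>n. a n x)"
    using a by (intro Met_TC.continuous_map_uniform_limit[where F = sequentially and f = "\<lambda>N x. \<Sum>n<N. a n x"])
      (auto simp: uniform_limit_iff intro!: continuous_map_sum always_eventually)
  then show ?thesis by simp
qed

context Metric_space begin

lemma continuous_map_distance:
  assumes "continuous_map X mtopology f" "continuous_map X mtopology g"
  shows "continuous_map X euclideanreal (\<lambda>x. d (f x) (g x))"
  using continuous_map_mdist[of X Self f g] assms by (simp add: mtopology_of_def)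

lemma continuous_real_mball:
  assumes "continuous_map mtopology euclideanreal f" "x \<in> M" "0 < e"
  obtains r where "0 < r" "\<And>y. y \<in> mball x r \<Longrightarrow> \<bar>f y - f x\<bar> < e"
proof -
  obtain U where "openin mtopology U" "x \<in> U" "\<forall>y\<in>U. \<bar>f y - f x\<bar> < e"
    using assms(1)[unfolded continuous_map_real_nbhd, rule_format, of x e] assms(2,3) by auto
  then show ?thesis using that unfolding openin_mtopology by blast
qed

lemma compact_dense_sequence:
  assumes "compact_space mtopology" "M \<noteq> {}"
  obtains q :: "nat \<Rightarrow> 'a" where "\<And>n. q n \<in> M" "\<And>x e. x \<in> M \<Longrightarrow> 0 < e \<Longrightarrow> \<exists>n. d x (q n) < e"
proof -
  have "mtotally_bounded M"
    using assms(1) compact_space_eq_mcomplete_mtotally_bounded by blast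
  then have "\<exists>N. finite N \<and> N \<subseteq> M \<and> M \<subseteq> (\<Union>x\<in>N. mball x (1 / real (Suc k)))" for k
    by (auto simp: mtotally_bounded_def)
  then obtain N where N: "\<And>k. finite (N k)" "\<And>k. N k \<subseteq> M"
      "\<And>k. M \<subseteq> (\<Union>x\<in>N k. mball x (1 / real (Suc k)))" by metis
  let ?S = "\<Union>k. N k"
  have S: "countable ?S" using N(1) by (auto intro: countable_finite)
  have near: "\<exists>s\<in>?S. d x s < e" if x: "x \<in> M" and "0 < e" for x e
  proof -
    obtain k where k: "1 / real (Suc k) < e" using \<open>0 < e\<close> nat_approx_posE by blast
    obtain s where "s \<in> N k" "x \<in> mball s (1 / real (Suc k))" using N(3)[of k] x by blast
    with k show ?thesis by (intro bexI[of _ s]) (auto simp: commute)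
  qed
  moreover have S0: "?S \<noteq> {}" using near assms(2) zero_less_one by blast
  ultimately show ?thesis
    using that[of "from_nat_into ?S"] N(2) from_nat_into[OF S0] from_nat_into_surj[OF S]
    by (metis UN_E subsetD)
qed

end

text \<open>Over a point \<open>y\<close> of \<open>F\<close>, the metric measures the distance of \<open>\<rho> y\<close> to the points of \<open>L\<close>. This
  extends to all of \<open>K\<close>: a Tietze extension \<open>g\<close> of \<open>d (\<rho> y) x\<close> to \<open>K \<times> L\<close> assigns to each
  \<open>y\<close> the function \<open>g (y, \<cdot>)\<close>, and \<open>D y x\<close> is its sup distance from \<open>d x \<cdot>\<close>. As
  \<open>x \<mapsto> d x \<cdot>\<close> is the isometric Kuratowski embedding of \<open>L\<close>, the triangle inequality
  survives; in particular \<open>D y\<close> has at most one zero even for \<open>y\<close> outside \<open>F\<close>.\<close>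

lemma extended_distance:
  fixes K :: "'a topology"
  assumes K: "compact_space K" "Hausdorff_space K"
    and "Metric_space L d" and L: "compact_space (Metric_space.mtopology L d)" "L \<noteq> {}"
    and F: "closedin K F" and \<rho>: "continuous_map (subtopology K F) (Metric_space.mtopology L d) \<rho>"
  obtains D :: "'a \<Rightarrow> 'b \<Rightarrow> real" where
    "continuous_map (prod_topology K (Metric_space.mtopology L d)) euclideanreal (\<lambda>(y,x). D y x)"
    "\<And>y x. y \<in> F \<Longrightarrow> x \<in> L \<Longrightarrow> D y x = d (\<rho> y) x"
    "\<And>y x x'. y \<in> topspace K \<Longrightarrow> x \<in> L \<Longrightarrow> x' \<in> L \<Longrightarrow> d x x' \<le> D y x + D y x'"
proof -
  interpret Metric_space L d by fact
  let ?P = "prod_topology K mtopology"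
  have \<rho>L: "\<rho> y \<in> L" if "y \<in> F" for y
    using \<rho> that closedin_subset[OF F] by (auto simp: continuous_map_def)
  have "compact_space ?P" "Hausdorff_space ?P"
    using K L(1) Hausdorff_space_mtopology by (auto simp: compact_space_prod_topology Hausdorff_space_prod_topology)
  then have "normal_space ?P" by (simp add: compact_Hausdorff_or_regular_imp_normal_space)
  moreover have "closedin ?P (F \<times> L)" using F by (simp add: closedin_prod_Times_iff)
  moreover have "continuous_map (subtopology ?P (F \<times> L)) euclideanreal (\<lambda>p. d (\<rho> (fst p)) (snd p))"
    unfolding subtopology_Times
    by (intro continuous_map_distance continuous_map_compose[OF continuous_map_fst \<rho>, unfolded o_def]
        continuous_map_into_fulltopology[OF continuous_map_snd])
  ultimately obtain g where g: "continuous_map ?P euclideanreal g"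
      "\<And>p. p \<in> F \<times> L \<Longrightarrow> g p = d (\<rho> (fst p)) (snd p)"
    using Tietze_extension_realinterval[of ?P "F \<times> L" UNIV "\<lambda>p. d (\<rho> (fst p)) (snd p)"] is_interval_univ
    by (metis UNIV_not_empty subset_UNIV)
  define G where "G p z = \<bar>g (fst p, z) - d (snd p) z\<bar>" for p z
  have G: "continuous_map (prod_topology ?P mtopology) euclideanreal (\<lambda>(p,z). G p z)"
    unfolding G_def case_prod_beta
    by (intro continuous_intros continuous_map_distance continuous_map_compose[OF _ g(1), unfolded o_def]
        continuous_map_compose[OF continuous_map_fst continuous_map_fst, unfolded o_def]
        continuous_map_compose[OF continuous_map_fst continuous_map_snd, unfolded o_def])
  have tL: "topspace mtopology \<noteq> {}" using L(2) by simp
  note sup = continuous_map_SUP_compact(2,3)[OF L(1) tL G]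
  define D where "D y x = (SUP z\<in>topspace mtopology. G (y, x) z)" for y x
  have up: "G (y, x) z \<le> D y x" if "y \<in> topspace K" "x \<in> L" "z \<in> L" for y x z
    unfolding D_def using that by (intro sup(1)) auto
  show thesis
  proof (rule that[of D])
    show "continuous_map ?P euclideanreal (\<lambda>(y,x). D y x)"
      using sup(2) by (simp add: D_def case_prod_unfold)
    show "D y x = d (\<rho> y) x" if y: "y \<in> F" and x: "x \<in> L" for y x
    proof (rule antisym)
      have Gy: "G (y, x) z = \<bar>d (\<rho> y) z - d x z\<bar>" if "z \<in> L" for z
        using g(2)[of "(y, z)"] y that by (simp add: G_def)
      show "D y x \<le> d (\<rho> y) x"
        unfolding D_def
      proof (rule cSUP_least[OF tL])
        fix z assume "z \<in> topspace mtopology"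
        then have z: "z \<in> L" by simp
        show "G (y, x) z \<le> d (\<rho> y) x"
          using mdist_reverse_triangle[OF \<rho>L[OF y] z x] commute[of z x] by (simp add: Gy[OF z])
      qed
      have "G (y, x) x = d (\<rho> y) x" using Gy[OF x] x \<rho>L[OF y] by simp
      then show "d (\<rho> y) x \<le> D y x" using up[of y x x] x y closedin_subset[OF F] by auto
    qed
    show "d x x' \<le> D y x + D y x'" if "y \<in> topspace K" "x \<in> L" "x' \<in> L" for y x x'
      using up[of y x x'] up[of y x' x'] that by (simp add: G_def)
  qed
qed

text \<open>A Dugundji type extension of \<open>f \<circ> \<rho>\<close> from \<open>F\<close> to \<open>K\<close> that is linear and positive in
  \<open>f\<close>. Let \<open>\<delta> y\<close> be the minimum of \<open>D y\<close>. Where it is positive, \<open>T f y\<close> is a weighted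
  average of the values of \<open>f\<close> at a dense sequence, with weights that vanish at points farther than
  \<open>2 * \<delta> y\<close> from \<open>y\<close>; where \<open>\<delta> y = 0\<close>, it is the value of \<open>f\<close> at the unique zero of
  \<open>D y\<close>. In both cases \<open>T f y\<close> is an average of values of \<open>f\<close> at points \<open>x\<close> with
  \<open>D y x \<le> 2 * \<delta> y\<close>, which gives continuity at the zeros of \<open>\<delta>\<close>.\<close>

theorem positive_extension_operator:
  fixes K :: "'a topology" and L :: "'b set"
  assumes K: "compact_space K" "Hausdorff_space K"
    and "Metric_space L d" and L: "compact_space (Metric_space.mtopology L d)" "L \<noteq> {}"
    and F: "closedin K F" and \<rho>: "continuous_map (subtopology K F) (Metric_space.mtopology L d) \<rho>"
  obtains T where "linear_operator (cfun (Metric_space.mtopology L d)) (cfun K) T"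
    "positive_operator (cfun (Metric_space.mtopology L d)) T"
    "T (indicator L) = indicator (topspace K)"
    "\<And>f y. f \<in> cfun (Metric_space.mtopology L d) \<Longrightarrow> y \<in> F \<Longrightarrow> T f y = f (\<rho> y)"
proof -
  interpret Metric_space L d by fact
  obtain D :: "'a \<Rightarrow> 'b \<Rightarrow> real" where
    D: "continuous_map (prod_topology K mtopology) euclideanreal (\<lambda>(y,x). D y x)"
    and D_F: "\<And>y x. y \<in> F \<Longrightarrow> x \<in> L \<Longrightarrow> D y x = d (\<rho> y) x"
    and D_tri: "\<And>y x x'. y \<in> topspace K \<Longrightarrow> x \<in> L \<Longrightarrow> x' \<in> L \<Longrightarrow> d x x' \<le> D y x + D y x'"
    using extended_distance[OF assms] by blast
  obtain q :: "nat \<Rightarrow> 'b" where q: "\<And>n. q n \<in> L" "\<And>x e. x \<in> L \<Longrightarrow> 0 < e \<Longrightarrow> \<exists>n. d x (q n) < e"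
    using compact_dense_sequence[OF L] by blast
  have tL: "topspace mtopology \<noteq> {}" using L(2) by simp
  have negD: "continuous_map (prod_topology K mtopology) euclideanreal (\<lambda>(y,x). - D y x)"
    using continuous_map_minus[OF D] by (simp add: case_prod_unfold)
  have D_slice1: "continuous_map K euclideanreal (\<lambda>y. D y x)" if "x \<in> L" for x
    using continuous_map_compose[OF _ D, of K "\<lambda>y. (y, x)"] that
    by (simp add: continuous_map_paired o_def)
  have D_slice2: "continuous_map mtopology euclideanreal (\<lambda>x. D y x)" if "y \<in> topspace K" for y
    using continuous_map_compose[OF _ D, of mtopology "\<lambda>x. (y, x)"] that
    by (simp add: continuous_map_paired o_def)
  have D_nonneg: "0 \<le> D y x" if "y \<in> topspace K" "x \<in> L" for y x
    using D_tri[of y x x] that by simp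
  define \<delta> where "\<delta> y = - (SUP x\<in>topspace mtopology. - D y x)" for y
  have \<delta>_attained: "\<exists>x\<in>L. D y x = \<delta> y" if "y \<in> topspace K" for y
    using continuous_map_SUP_compact(1)[OF L(1) tL negD that] by (force simp: \<delta>_def)
  have \<delta>_le: "\<delta> y \<le> D y x" if "y \<in> topspace K" "x \<in> L" for y x
    using continuous_map_SUP_compact(2)[OF L(1) tL negD that(1), of x] that(2) by (simp add: \<delta>_def)
  have \<delta>: "continuous_map K euclideanreal \<delta>"
    unfolding \<delta>_def by (intro continuous_map_minus continuous_map_SUP_compact(3)[OF L(1) tL negD])
  have \<delta>_nonneg: "0 \<le> \<delta> y" if "y \<in> topspace K" for y
    using \<delta>_attained[OF that] D_nonneg[OF that] by force
  define B where "B = sup_norm K (\<lambda>y. if y \<in> topspace K then \<delta> y else 0)"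
  have \<delta>_B: "\<delta> y \<le> B" if "y \<in> topspace K" for y
    using sup_norm_upper[OF K(1) cfun_cut[OF \<delta>], of y] that by (simp add: B_def)
  \<comment> \<open>a nearest point; it is the zero of \<open>D y\<close> where \<open>\<delta> y = 0\<close>\<close>
  define p where "p y = (SOME x. x \<in> L \<and> D y x = \<delta> y)" for y
  have p: "p y \<in> L" "D y (p y) = \<delta> y" if "y \<in> topspace K" for y
    using someI_ex[of "\<lambda>x. x \<in> L \<and> D y x = \<delta> y"] \<delta>_attained[OF that] by (auto simp: p_def)

  \<comment> \<open>the factor 2 keeps a neighbourhood of the nearest points in play, so a point of the dense sequence gets positive weight\<close>
  define a where "a n y = (1/2) ^ n * max 0 (2 * \<delta> y - D y (q n))" for n y
  have a: "continuous_map K euclideanreal (a n)" for n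
    unfolding a_def using q(1)
    by (intro continuous_intros continuous_map_real_mult_left \<delta> D_slice1) auto
  have a_nonneg: "0 \<le> a n y" for n y by (simp add: a_def)
  have a_le: "a n y \<le> (1/2) ^ n * (2 * B)" if "y \<in> topspace K" for n y
    unfolding a_def using \<delta>_B[OF that] \<delta>_nonneg[OF that] D_nonneg[OF that q(1), of n]
    by (intro mult_left_mono) auto
  define S where "S f y = (\<Sum>n. a n y * f (q n))" for f y
  have af_le: "\<bar>a n y * f (q n)\<bar> \<le> (1/2) ^ n * (2 * B) * sup_norm mtopology f"
    if "f \<in> cfun mtopology" "y \<in> topspace K" for f n y
    unfolding abs_mult
    using a_nonneg[of n y] a_le[OF that(2), of n] sup_norm_upper[OF L(1) that(1), of "q n"]
      order_trans[OF a_nonneg a_le[OF that(2), of n]]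
    by (intro mult_mono) auto
  have sum_af_le: "summable (\<lambda>n. (1/2) ^ n * (2 * B) * sup_norm mtopology f)" for f
    by (intro summable_mult2 summable_geometric) simp
  have summ: "summable (\<lambda>n. a n y * f (q n))" if "f \<in> cfun mtopology" "y \<in> topspace K" for f y
    by (rule summable_comparison_test'[OF sum_af_le[of f], of 0]) (use af_le[OF that] in simp)
  have S: "continuous_map K euclideanreal (S f)" if f: "f \<in> cfun mtopology" for f
    unfolding S_def
    by (rule continuous_map_suminf[OF _ af_le[OF f] sum_af_le])
       (auto intro!: continuous_map_real_mult_right a)
  let ?one = "indicator L :: 'b \<Rightarrow> real"
  have one: "?one \<in> cfun mtopology" using cfun_one[of mtopology] by simp
  define W where "W = S ?one"
  have W_eq: "W y = (\<Sum>n. a n y)" for y unfolding W_def S_def using q(1) by simp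
  have summ_a: "summable (\<lambda>n. a n y)" if "y \<in> topspace K" for y
    using summ[OF one that] q(1) by simp
  have W_pos: "0 < W y" if y: "y \<in> topspace K" and pos: "0 < \<delta> y" for y
  proof -
    obtain r where "0 < r" "\<And>x. x \<in> mball (p y) r \<Longrightarrow> \<bar>D y x - D y (p y)\<bar> < \<delta> y"
      using continuous_real_mball[OF D_slice2[OF y] p(1)[OF y] pos] by blast
    then obtain n where "\<bar>D y (q n) - \<delta> y\<bar> < \<delta> y"
      using q p[OF y] by (metis in_mball)
    then have "0 < a n y" by (simp add: a_def)
    then show ?thesis
      unfolding W_eq using suminf_pos2[OF summ_a[OF y] a_nonneg] by blast
  qed

  define T where
    "T f y = (if y \<in> topspace K then if \<delta> y = 0 then f (p y) else S f y / W y else 0)" for f y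
  have T_local: "\<bar>T f y - v\<bar> \<le> c"
    if f: "f \<in> cfun mtopology" and y: "y \<in> topspace K"
      and near: "\<And>x. x \<in> L \<Longrightarrow> D y x \<le> 2 * \<delta> y \<Longrightarrow> \<bar>f x - v\<bar> \<le> c" for f y v c
  proof (cases "\<delta> y = 0")
    case True
    then show ?thesis using near[of "p y"] p[OF y] y by (simp add: T_def)
  next
    case False
    then have W: "0 < W y" using W_pos[OF y] \<delta>_nonneg[OF y] by simp
    have summand: "a n y * (v - c) \<le> a n y * f (q n)" "a n y * f (q n) \<le> a n y * (v + c)" for n
    proof -
      have "a n y = 0 \<or> \<bar>f (q n) - v\<bar> \<le> c"
        using near[OF q(1), of n] by (cases "D y (q n) \<le> 2 * \<delta> y") (simp_all add: a_def max_def)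
      then show "a n y * (v - c) \<le> a n y * f (q n)" "a n y * f (q n) \<le> a n y * (v + c)"
        using mult_left_mono[OF _ a_nonneg[of n y], of "v - c" "f (q n)"]
          mult_left_mono[OF _ a_nonneg[of n y], of "f (q n)" "v + c"] by auto
    qed
    have "W y * (v - c) \<le> S f y"
      unfolding W_eq S_def suminf_mult2[OF summ_a[OF y]]
      by (intro suminf_le summand summ[OF f y] summable_mult2 summ_a y)
    moreover have "S f y \<le> W y * (v + c)"
      unfolding W_eq S_def suminf_mult2[OF summ_a[OF y]]
      by (intro suminf_le summand summ[OF f y] summable_mult2 summ_a y)
    ultimately have "v - c \<le> S f y / W y" "S f y / W y \<le> v + c"
      using W by (simp_all add: field_simps)
    then show ?thesis using y False by (simp add: T_def abs_le_iff)
  qed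

  have T_cont: "continuous_map K euclideanreal (T f)" if f: "f \<in> cfun mtopology" for f
    unfolding continuous_map_real_nbhd
  proof (intro ballI allI impI)
    fix y and e :: real assume y: "y \<in> topspace K" and "0 < e"
    show "\<exists>U. openin K U \<and> y \<in> U \<and> (\<forall>y'\<in>U. \<bar>T f y' - T f y\<bar> < e)"
    proof (cases "\<delta> y = 0")
      case True
      obtain r where r: "0 < r" "\<And>x. x \<in> mball (p y) r \<Longrightarrow> \<bar>f x - f (p y)\<bar> < e / 2"
        using continuous_real_mball[OF cfun_continuous[OF f] p(1)[OF y] half_gt_zero[OF \<open>0 < e\<close>]] by blast
      \<comment> \<open>there \<open>\<delta> < r / 3\<close>, so the points that are averaged satisfy \<open>D y' x < 2 * r / 3\<close> and lie within \<open>r\<close> of \<open>p y\<close>\<close>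
      let ?U = "{y' \<in> topspace K. D y' (p y) < r / 3}"
      have "openin K ?U" using D_slice1[OF p(1)[OF y]] by (intro openin_less) auto
      moreover have "y \<in> ?U" using p[OF y] y True r(1) by simp
      moreover have "\<bar>T f y' - T f y\<bar> < e" if y': "y' \<in> ?U" for y'
      proof -
        have "\<bar>T f y' - f (p y)\<bar> \<le> e / 2"
        proof (rule T_local[OF f])
          show "y' \<in> topspace K" using y' by simp
          fix x assume x: "x \<in> L" "D y' x \<le> 2 * \<delta> y'"
          have "d (p y) x \<le> D y' (p y) + D y' x" using y' x p[OF y] by (intro D_tri) auto
          also have "\<dots> < r" using x(2) y' \<delta>_le[of y' "p y"] p[OF y] by auto
          finally have "x \<in> mball (p y) r" using x(1) p[OF y] by simp
          then show "\<bar>f x - f (p y)\<bar> \<le> e / 2" using r(2) by (auto intro: less_imp_le)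
        qed
        moreover have "T f y = f (p y)" using y True by (simp add: T_def)
        ultimately show ?thesis using \<open>0 < e\<close> by simp
      qed
      ultimately show ?thesis by blast
    next
      case False
      let ?V = "{y \<in> topspace K. 0 < \<delta> y}"
      have V: "openin K ?V" using \<delta> by (intro openin_less) auto
      have SW: "continuous_map (subtopology K ?V) euclideanreal (\<lambda>y. S f y / W y)"
        using W_pos unfolding W_def
        by (intro continuous_map_real_divide continuous_map_from_subtopology S f one) force
      have yV: "y \<in> topspace (subtopology K ?V)" using y False \<delta>_nonneg[OF y] by simp
      obtain U where U: "openin (subtopology K ?V) U" "y \<in> U"
          "\<And>y'. y' \<in> U \<Longrightarrow> \<bar>S f y' / W y' - S f y / W y\<bar> < e"
        using SW[unfolded continuous_map_real_nbhd, rule_format, OF yV \<open>0 < e\<close>] by blast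
      have "U \<subseteq> ?V" using openin_subset[OF U(1)] by auto
      then have "T f y' = S f y' / W y'" if "y' \<in> U" for y' using that by (auto simp: T_def)
      moreover have "openin K U" using U(1) V openin_trans_full by blast
      ultimately show ?thesis using U(2,3) by metis
    qed
  qed

  show thesis
  proof (rule that[of T])
    show "linear_operator (cfun mtopology) (cfun K) T"
      unfolding linear_operator_def
    proof (intro conjI ballI allI)
      show "T \<in> cfun mtopology \<rightarrow> cfun K"
        using T_cont by (auto simp: cfun_def T_def)
      show "T (\<lambda>x. f x + g x) = (\<lambda>y. T f y + T g y)"
        if f: "f \<in> cfun mtopology" and g: "g \<in> cfun mtopology" for f g
      proof
        fix y show "T (\<lambda>x. f x + g x) y = T f y + T g y"
          using suminf_add[OF summ[OF f, of y] summ[OF g, of y], symmetric]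
          by (auto simp: T_def S_def distrib_left add_divide_distrib)
      qed
      show "T (\<lambda>x. c * f x) = (\<lambda>y. c * T f y)" if f: "f \<in> cfun mtopology" for c f
      proof
        fix y show "T (\<lambda>x. c * f x) y = c * T f y"
          using suminf_mult[OF summ[OF f, of y], of c]
          by (auto simp: T_def S_def mult.left_commute)
      qed
    qed
    show "positive_operator (cfun mtopology) T"
      unfolding positive_operator_def
    proof (intro ballI impI allI)
      fix f y assume f: "f \<in> cfun mtopology" "\<forall>x. 0 \<le> f x"
      have "0 \<le> S f y" "0 \<le> W y" if "y \<in> topspace K"
        unfolding S_def W_eq using f a_nonneg summ[OF f(1) that] summ_a[OF that]
        by (auto intro!: suminf_nonneg)
      then show "0 \<le> T f y" using f by (simp add: T_def)
    qed
    show "T (indicator L) = indicator (topspace K)"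
    proof
      fix y
      have "W y \<noteq> 0" if "y \<in> topspace K" "\<delta> y \<noteq> 0"
        using W_pos[OF that(1)] \<delta>_nonneg[OF that(1)] that(2) by force
      then show "T (indicator L) y = indicator (topspace K) y"
        using p[of y] by (simp add: T_def flip: W_def)
    qed
    show "T f y = f (\<rho> y)" if f: "f \<in> cfun mtopology" and y: "y \<in> F" for f y
    proof -
      have yK: "y \<in> topspace K" using y closedin_subset[OF F] by blast
      have \<rho>y: "\<rho> y \<in> L" using \<rho> y yK by (auto simp: continuous_map_def)
      have "\<delta> y \<le> 0" using \<delta>_le[OF yK \<rho>y] D_F[OF y \<rho>y] \<rho>y by simp
      then have 0: "\<delta> y = 0" using \<delta>_nonneg[OF yK] by simp
      then have "d (\<rho> y) (p y) = 0" using D_F[OF y p(1)[OF yK]] p(2)[OF yK] by simp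
      then have "p y = \<rho> y" using \<rho>y p(1)[OF yK] by simp
      then show ?thesis using 0 yK by (simp add: T_def)
    qed
  qed
qed

section \<open>Positive operators between function spaces\<close>

lemma linear_operatorD:
  assumes "linear_operator (cfun X) W T"
  shows "f \<in> cfun X \<Longrightarrow> T f \<in> W"
    and "f \<in> cfun X \<Longrightarrow> g \<in> cfun X \<Longrightarrow> T (\<lambda>x. f x + g x) = (\<lambda>y. T f y + T g y)"
    and "f \<in> cfun X \<Longrightarrow> T (\<lambda>x. c * f x) = (\<lambda>y. c * T f y)"
    and "f \<in> cfun X \<Longrightarrow> g \<in> cfun X \<Longrightarrow> T (\<lambda>x. f x - g x) = (\<lambda>y. T f y - T g y)"
proof -
  show add: "f \<in> cfun X \<Longrightarrow> g \<in> cfun X \<Longrightarrow> T (\<lambda>x. f x + g x) = (\<lambda>y. T f y + T g y)" for f g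
    using assms by (auto simp: linear_operator_def)
  show scale: "f \<in> cfun X \<Longrightarrow> T (\<lambda>x. c * f x) = (\<lambda>y. c * T f y)" for c f
    using assms unfolding linear_operator_def by blast
  show "f \<in> cfun X \<Longrightarrow> T f \<in> W" using assms by (auto simp: linear_operator_def)
  show "f \<in> cfun X \<Longrightarrow> g \<in> cfun X \<Longrightarrow> T (\<lambda>x. f x - g x) = (\<lambda>y. T f y - T g y)"
    using add[of f "\<lambda>x. (-1) * g x"] scale[of g "-1"] cfun_scale[of g X "-1"] by simp
qed

lemma positive_operator_mono:
  assumes "linear_operator (cfun X) W T" "positive_operator (cfun X) T"
    and f: "f \<in> cfun X" and g: "g \<in> cfun X" and "\<And>x. f x \<le> g x"
  shows "T f y \<le> T g y"
proof -
  have "0 \<le> T (\<lambda>x. g x - f x) y"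
    using assms(2,5) cfun_diff[OF g f] unfolding positive_operator_def by simp
  then show ?thesis using linear_operatorD(4)[OF assms(1) g f] by simp
qed

lemma positive_operator_abs_le:
  assumes T: "linear_operator (cfun X) W T" "positive_operator (cfun X) T"
    and f: "f \<in> cfun X" and g: "g \<in> cfun X" and le: "\<And>x. \<bar>f x\<bar> \<le> g x"
  shows "\<bar>T f y\<bar> \<le> T g y"
proof -
  have "T f y \<le> T g y"
    using le by (intro positive_operator_mono[OF T f g]) (simp add: abs_le_iff)
  moreover have "T (\<lambda>x. (-1) * f x) y \<le> T g y"
    using le by (intro positive_operator_mono[OF T cfun_scale[OF f] g]) (simp add: abs_le_iff)
  ultimately show ?thesis using linear_operatorD(3)[OF T(1) f, of "-1"] by (simp add: abs_le_iff)
qed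

lemma abs_le_sup_norm_one:
  assumes "compact_space X" "f \<in> cfun X"
  shows "\<bar>f x\<bar> \<le> sup_norm X f * indicator (topspace X) x"
  using sup_norm_upper[OF assms, of x] cfun_outside[OF assms(2), of x] by (auto simp: indicator_def)

lemma sup_norm_nonneg: "compact_space X \<Longrightarrow> f \<in> cfun X \<Longrightarrow> 0 \<le> sup_norm X f"
  using sup_norm_upper[of X f undefined] by linarith

lemma positive_operator_contraction:
  assumes X: "compact_space X" and T: "linear_operator (cfun X) W T" "positive_operator (cfun X) T"
    and one: "\<And>y. T (indicator (topspace X)) y \<le> 1" and f: "f \<in> cfun X"
  shows "\<bar>T f y\<bar> \<le> sup_norm X f" "sup_norm Y (T f) \<le> sup_norm X f"
proof -
  show *: "\<bar>T f y\<bar> \<le> sup_norm X f" for y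
  proof -
    have "\<bar>T f y\<bar> \<le> T (\<lambda>x. sup_norm X f * indicator (topspace X) x) y"
      using abs_le_sup_norm_one[OF X f]
      by (intro positive_operator_abs_le[OF T f]) (auto intro: cfun_scale cfun_one)
    also have "\<dots> = sup_norm X f * T (indicator (topspace X)) y"
      by (simp add: linear_operatorD(3)[OF T(1) cfun_one])
    also have "\<dots> \<le> sup_norm X f"
      using mult_left_mono[OF one sup_norm_nonneg[OF X f]] by simp
    finally show ?thesis .
  qed
  show "sup_norm Y (T f) \<le> sup_norm X f"
    by (intro sup_norm_least sup_norm_nonneg X f *)
qed

section \<open>Projections and retractions of function spaces\<close>

text \<open>The operator \<open>T\<close> is isometric because \<open>T\<close> and its left inverse \<open>A\<close> are both
  contractions, and \<open>P = T \<circ> A\<close> is the projection. Its range is closed since it is the set of fixed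
  points of a contraction.\<close>

lemma projection_from_section:
  assumes K: "compact_space K" and L: "compact_space L" "topspace L \<noteq> {}"
    and T: "linear_operator (cfun L) (cfun K) T" "positive_operator (cfun L) T"
      "T (indicator (topspace L)) = indicator (topspace K)"
    and A: "linear_operator (cfun K) (cfun L) A" "positive_operator (cfun K) A"
      "A (indicator (topspace K)) = indicator (topspace L)"
    and AT: "\<And>f. f \<in> cfun L \<Longrightarrow> A (T f) = f"
  shows "\<exists>E T P. closed_linear_subspace K E \<and> surjective_isometry L K E T \<and>
            positive_operator (cfun L) T \<and>
            projection_onto K E P \<and> positive_operator (cfun K) P \<and> operator_norm K K P = 1"
proof (intro exI conjI)
  define E where "E = T ` cfun L"
  define P where "P g = T (A g)" for g
  note TD = linear_operatorD[OF T(1)] and AD = linear_operatorD[OF A(1)]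
  have E_cfun: "E \<subseteq> cfun K" using TD(1) by (auto simp: E_def)
  have P_E: "P g = g" if "g \<in> E" for g using that AT by (auto simp: E_def P_def)
  have P_in: "P g \<in> E" if "g \<in> cfun K" for g using AD(1)[OF that] by (simp add: E_def P_def)
  have P_lin: "linear_operator (cfun K) E P"
    unfolding linear_operator_def using P_in AD TD by (auto simp: P_def)
  show P_pos: "positive_operator (cfun K) P"
    using T(2) A(2) AD(1) unfolding positive_operator_def P_def by blast
  have P_one: "P (indicator (topspace K)) = indicator (topspace K)" by (simp add: P_def A(3) T(3))
  have T_contr: "sup_norm K (T f) \<le> sup_norm L f" if "f \<in> cfun L" for f
    by (rule positive_operator_contraction[OF L(1) T(1,2) _ that]) (simp add: T(3))
  have A_contr: "sup_norm L (A g) \<le> sup_norm K g" if "g \<in> cfun K" for g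
    by (rule positive_operator_contraction[OF K A(1,2) _ that]) (simp add: A(3))
  have P_contr: "\<bar>P g y\<bar> \<le> sup_norm K g" "sup_norm K (P g) \<le> sup_norm K g" if "g \<in> cfun K" for g y
    by (rule positive_operator_contraction[OF K P_lin P_pos _ that]; simp add: P_one)+
  have T_iso: "sup_norm K (T f) = sup_norm L f" if "f \<in> cfun L" for f
    using T_contr[OF that] A_contr[OF TD(1)[OF that]] AT[OF that] by simp
  show "surjective_isometry L K E T"
    unfolding surjective_isometry_def
    using T_iso TD by (auto simp: E_def linear_operator_def)
  show "positive_operator (cfun L) T" by fact
  show "projection_onto K E P"
    unfolding projection_onto_def bounded_operator_def
    using P_lin P_E P_contr(2) by (auto intro: exI[of _ 1])
  show "closed_linear_subspace K E"
    unfolding closed_linear_subspace_def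
  proof (intro conjI E_cfun)
    show "linear_subspace E"
      unfolding linear_subspace_def
    proof (intro conjI ballI allI)
      show "(\<lambda>x. 0) \<in> E"
        using TD(3)[OF cfun_zero, of 0] cfun_zero by (force simp: E_def)
      show "(\<lambda>x. f x + g x) \<in> E" if "f \<in> E" "g \<in> E" for f g
      proof -
        obtain a b where "a \<in> cfun L" "b \<in> cfun L" "f = T a" "g = T b"
          using \<open>f \<in> E\<close> \<open>g \<in> E\<close> by (auto simp: E_def)
        then have "(\<lambda>x. f x + g x) = T (\<lambda>x. a x + b x)" "(\<lambda>x. a x + b x) \<in> cfun L"
          by (simp_all add: TD(2) cfun_add)
        then show ?thesis unfolding E_def by (rule image_eqI)
      qed
      show "(\<lambda>x. c * f x) \<in> E" if "f \<in> E" for c f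
      proof -
        obtain a where "a \<in> cfun L" "f = T a" using \<open>f \<in> E\<close> by (auto simp: E_def)
        then have "(\<lambda>x. c * f x) = T (\<lambda>x. c * a x)" "(\<lambda>x. c * a x) \<in> cfun L"
          by (simp_all add: TD(3) cfun_scale)
        then show ?thesis unfolding E_def by (rule image_eqI)
      qed
    qed
    interpret C: Metric_space "cfun K" "sup_dist K" using K by (rule Metric_space_cfun)
    \<comment> \<open>if \<open>P g\<close> and \<open>g\<close> differ by \<open>r\<close> at a point, a fixed point \<open>h\<close> of \<open>P\<close> has distance at least \<open>r / 2\<close> from \<open>g\<close>\<close>
    show "closedin C.mtopology E"
      unfolding C.closedin_metric
    proof (intro conjI E_cfun allI impI)
      fix g assume "g \<in> cfun K - E"
      then have g: "g \<in> cfun K" and "P g \<noteq> g" using P_in by force+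
      then obtain y where y: "0 < \<bar>P g y - g y\<bar>" by auto
      have "h \<notin> C.mball g (\<bar>P g y - g y\<bar> / 2)" if h: "h \<in> E" for h
      proof
        assume "h \<in> C.mball g (\<bar>P g y - g y\<bar> / 2)"
        then have gh: "(\<lambda>x. g x - h x) \<in> cfun K" "sup_norm K (\<lambda>x. g x - h x) < \<bar>P g y - g y\<bar> / 2"
          using g cfun_diff[of g K h] by (auto simp: sup_dist_def)
        define s where "s = sup_norm K (\<lambda>x. g x - h x)"
        have "\<bar>P g y - h y\<bar> \<le> s"
          unfolding s_def using P_contr(1)[OF gh(1), of y] linear_operatorD(4)[OF P_lin g, of h] h E_cfun P_E[OF h] by auto
        moreover have "\<bar>g y - h y\<bar> \<le> s"
          unfolding s_def using sup_norm_upper[OF K gh(1), of y] by simp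
        moreover have "2 * s < \<bar>P g y - g y\<bar>" using gh(2) by (simp add: s_def)
        ultimately show False by linarith
      qed
      then show "\<exists>r>0. disjnt E (C.mball g r)"
        using y by (intro exI[of _ "\<bar>P g y - g y\<bar> / 2"]) (auto simp: disjnt_def)
    qed
  qed
  have norm_one: "sup_norm K (indicator (topspace K)) = 1"
  proof -
    have "sup_norm L (indicator (topspace L)) = 1"
    proof (rule antisym)
      obtain x where "x \<in> topspace L" using L(2) by blast
      then show "1 \<le> sup_norm L (indicator (topspace L))"
        using sup_norm_upper[OF L(1) cfun_one, of x] by simp
    qed (rule sup_norm_least; simp)
    then show ?thesis using T_iso[OF cfun_one] by (simp add: T(3))
  qed
  show "operator_norm K K P = 1"
    unfolding operator_norm_def
  proof (rule cSup_eq_maximum)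
    have "indicator (topspace K) \<in> {f \<in> cfun K. sup_norm K f \<le> 1}" by (simp add: cfun_one norm_one)
    then show "1 \<in> (\<lambda>f. sup_norm K (P f)) ` {f \<in> cfun K. sup_norm K f \<le> 1}"
      by (rule rev_image_eqI) (simp add: P_one norm_one)
    show "x \<le> 1" if "x \<in> (\<lambda>f. sup_norm K (P f)) ` {f \<in> cfun K. sup_norm K f \<le> 1}" for x
      using that P_contr(2) by (auto intro: order_trans)
  qed
qed

text \<open>Conversely \<open>A = T\<inverse> \<circ> P\<close>. Here \<open>T\<inverse>\<close> is positive: if \<open>T f \<ge> 0\<close> and
  \<open>c\<close> is the norm of \<open>f\<close>, then \<open>c * T 1\<close> and \<open>T f\<close> both lie between 0 and
  \<open>c\<close>, so \<open>c * 1 - f\<close> has norm at most \<open>c\<close>, which forces \<open>f \<ge> 0\<close>. In this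
  direction only \<open>T 1 \<le> 1\<close> is available, but \<open>A 1 = 1\<close> follows: \<open>A 1 \<le> 1\<close> because
  \<open>P\<close> has norm 1, and \<open>1 = A (T 1) \<le> A 1\<close>.\<close>

lemma section_from_projection:
  assumes K: "compact_space K" and L: "compact_space L"
    and E: "E \<subseteq> cfun K" and T: "surjective_isometry L K E T" "positive_operator (cfun L) T"
    and P: "projection_onto K E P" "positive_operator (cfun K) P" "operator_norm K K P = 1"
  obtains A where "linear_operator (cfun L) (cfun K) T" "\<And>y. T (indicator (topspace L)) y \<le> indicator (topspace K) y"
    "linear_operator (cfun K) (cfun L) A" "positive_operator (cfun K) A"
    "A (indicator (topspace K)) = indicator (topspace L)"
    "\<And>f. f \<in> cfun L \<Longrightarrow> A (T f) = f"
proof -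
  have TE: "linear_operator (cfun L) E T" and im: "T ` cfun L = E"
    and iso: "\<And>f. f \<in> cfun L \<Longrightarrow> sup_norm K (T f) = sup_norm L f"
    using T(1) by (auto simp: surjective_isometry_def)
  have PE: "linear_operator (cfun K) E P" and P_id: "\<And>f. f \<in> E \<Longrightarrow> P f = f"
    using P(1) by (auto simp: projection_onto_def bounded_operator_def)
  obtain B where B: "\<And>f. f \<in> cfun K \<Longrightarrow> sup_norm K (P f) \<le> B * sup_norm K f"
    using P(1) by (auto simp: projection_onto_def bounded_operator_def)
  note TD = linear_operatorD[OF TE] and PD = linear_operatorD[OF PE]
  have T_lin: "linear_operator (cfun L) (cfun K) T"
    using TE E by (auto simp: linear_operator_def)
  let ?uK = "indicator (topspace K) :: 'a \<Rightarrow> real" and ?uL = "indicator (topspace L) :: 'b \<Rightarrow> real"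
  have norm_1: "sup_norm X (indicator (topspace X)) \<le> 1" for X :: "'c topology"
    by (rule sup_norm_least) auto
  have T1: "T ?uL y \<le> ?uK y" for y
    using sup_norm_upper[OF K, of "T ?uL" y] iso[OF cfun_one] norm_1[of L] E TD(1)[OF cfun_one[of L]]
      cfun_outside[of "T ?uL" K y] by (force simp: indicator_def)
  have P1: "\<bar>P ?uK y\<bar> \<le> 1" for y
  proof -
    have "bdd_above ((\<lambda>f. sup_norm K (P f)) ` {f \<in> cfun K. sup_norm K f \<le> 1})"
    proof (rule bdd_aboveI2)
      fix f assume f: "f \<in> {f \<in> cfun K. sup_norm K f \<le> 1}"
      have "B * sup_norm K f \<le> \<bar>B\<bar> * 1"
        using f sup_norm_nonneg[OF K, of f] by (intro mult_mono) auto
      then show "sup_norm K (P f) \<le> \<bar>B\<bar>" using B[of f] f by simp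
    qed
    then have "sup_norm K (P ?uK) \<le> operator_norm K K P"
      unfolding operator_norm_def using cfun_one norm_1 by (intro cSUP_upper) auto
    then show ?thesis using sup_norm_upper[OF K, of "P ?uK" y] PD(1)[OF cfun_one] E P(3) by force
  qed
  have T_reflects_pos: "0 \<le> f x" if f: "f \<in> cfun L" and Tf: "\<And>y. 0 \<le> T f y" for f x
  proof -
    define c where "c = sup_norm L f"
    have c: "0 \<le> c" unfolding c_def by (rule sup_norm_nonneg[OF L f])
    let ?g = "\<lambda>x. c * ?uL x - f x"
    have g: "?g \<in> cfun L" by (intro cfun_diff cfun_scale cfun_one f)
    have "\<bar>T ?g y\<bar> \<le> c" for y
    proof -
      have "T ?g y = c * T ?uL y - T f y"
        by (simp add: TD(4)[OF cfun_scale[OF cfun_one] f] TD(3)[OF cfun_one])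
      moreover have "0 \<le> T ?uL y" using T(2) cfun_one unfolding positive_operator_def by fastforce
      moreover have "T ?uL y \<le> 1" using T1[of y] by (auto intro: order_trans)
      moreover have "T f y \<le> c"
        using sup_norm_upper[OF K, of "T f" y] TD(1)[OF f] E iso[OF f] by (force simp: c_def)
      moreover from calculation have "0 \<le> c * T ?uL y" "c * T ?uL y \<le> c"
        using c by (auto intro: mult_left_le)
      ultimately show ?thesis using Tf[of y] by arith
    qed
    then have "sup_norm K (T ?g) \<le> c" using c by (intro sup_norm_least)
    then have "\<bar>?g x\<bar> \<le> c" using iso[OF g] sup_norm_upper[OF L g, of x] by simp
    then show ?thesis using cfun_outside[OF f, of x] by (cases "x \<in> topspace L") auto
  qed
  have T_inj: "inj_on T (cfun L)"
  proof (rule inj_onI)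
    fix f g assume fg: "f \<in> cfun L" "g \<in> cfun L" "T f = T g"
    then have "T (\<lambda>x. f x - g x) = (\<lambda>y. 0)" "T (\<lambda>x. g x - f x) = (\<lambda>y. 0)" by (simp_all add: TD(4))
    then show "f = g"
      using T_reflects_pos[of "\<lambda>x. f x - g x"] T_reflects_pos[of "\<lambda>x. g x - f x"] fg
      by (intro ext antisym) (simp_all add: cfun_diff)
  qed
  define A where "A g = inv_into (cfun L) T (P g)" for g
  have A: "A g \<in> cfun L" "T (A g) = P g" if "g \<in> cfun K" for g
    using PD(1)[OF that] inv_into_into[of "P g" T "cfun L"] f_inv_into_f[of "P g" T "cfun L"]
    unfolding A_def im by auto
  have A_eq: "A g = f" if "f \<in> cfun L" "T f = P g" for f g
    unfolding A_def using inv_into_f_f[OF T_inj that(1)] that(2) by simp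
  have A_lin: "linear_operator (cfun K) (cfun L) A"
    unfolding linear_operator_def
  proof (intro conjI ballI allI)
    show "A \<in> cfun K \<rightarrow> cfun L" using A(1) by blast
    show "A (\<lambda>x. f x + g x) = (\<lambda>x. A f x + A g x)" if f: "f \<in> cfun K" and g: "g \<in> cfun K" for f g
      by (rule A_eq) (simp_all add: cfun_add TD(2) PD(2) A f g)
    show "A (\<lambda>x. c * f x) = (\<lambda>x. c * A f x)" if f: "f \<in> cfun K" for c f
      by (rule A_eq) (simp_all add: cfun_scale TD(3) PD(3) A f)
  qed
  have A_pos: "positive_operator (cfun K) A"
    unfolding positive_operator_def using P(2) A T_reflects_pos by (auto simp: positive_operator_def)
  have AT: "A (T f) = f" if "f \<in> cfun L" for f
    using that P_id TD(1)[OF that] by (intro A_eq) auto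
  have "A ?uK = ?uL"
  proof (intro ext antisym)
    fix x
    have "sup_norm L (A ?uK) \<le> 1"
      using P1 iso[OF A(1)[OF cfun_one]] A(2)[OF cfun_one] sup_norm_least[of 1 K "P ?uK"] by simp
    then show "A ?uK x \<le> ?uL x"
      using abs_le_sup_norm_one[OF L A(1)[OF cfun_one], of x] by (auto simp: indicator_def split: if_splits)
    show "?uL x \<le> A ?uK x"
      using positive_operator_mono[OF A_lin A_pos _ cfun_one T1, of x] AT[OF cfun_one]
        linear_operatorD(1)[OF T_lin cfun_one] by simp
  qed
  then show ?thesis using that T_lin T1 A_lin A_pos AT by blast
qed

section \<open>Averaging over fibres\<close>

lemma continuous_map_weak_star_prob:
  "continuous_map Y (weak_star_prob X) \<phi> \<longleftrightarrow>
     (\<forall>y\<in>topspace Y. \<phi> y \<in> regular_prob X) \<and>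
     (\<forall>f\<in>cfun X. continuous_map Y euclideanreal (\<lambda>y. \<integral>x. f x \<partial>(\<phi> y)))"
  (is "?l \<longleftrightarrow> ?r")
proof -
  let ?ev = "\<lambda>\<mu>. \<lambda>f\<in>cfun X. \<integral>x. f x \<partial>\<mu>"
  let ?T = "product_topology (\<lambda>_. euclideanreal) (cfun X)"
  have ev: "continuous_map Y ?T (?ev \<circ> \<phi>) \<longleftrightarrow>
      (\<forall>f\<in>cfun X. continuous_map Y euclideanreal (\<lambda>y. \<integral>x. f x \<partial>(\<phi> y)))"
    unfolding continuous_map_componentwise by (simp add: o_def image_subset_iff)
  show ?thesis
  proof
    assume ?l
    then have "\<forall>y\<in>topspace Y. \<phi> y \<in> regular_prob X"
      by (auto simp: continuous_map_def weak_star_prob_def topspace_pullback_topology)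
    moreover have "continuous_map (weak_star_prob X) ?T (id \<circ> ?ev)"
      unfolding weak_star_prob_def by (intro continuous_map_pullback) simp
    then have "continuous_map Y ?T (?ev \<circ> \<phi>)"
      using continuous_map_compose[OF \<open>?l\<close>] by simp
    ultimately show ?r using ev by blast
  next
    assume ?r
    then show ?l
      unfolding weak_star_prob_def using ev by (intro continuous_map_pullback') auto
  qed
qed

lemma cfun_cut_subset:
  assumes "g \<in> cfun K" "F \<subseteq> topspace K"
  shows "(\<lambda>y. if y \<in> F then g y else 0) \<in> cfun (subtopology K F)"
proof -
  have "topspace (subtopology K F) = F" using assms(2) by auto
  then show ?thesis
    using cfun_cut[OF continuous_map_from_subtopology[OF cfun_continuous[OF assms(1)], of F]] by simp
qed

lemma AE_measure_support:
  assumes "\<mu> \<in> regular_prob X"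
  shows "AE x in \<mu>. x \<in> measure_support X \<mu>"
proof -
  have "openin X (topspace X - measure_support X \<mu>)"
    using measure_support_least(1)[OF assms] by blast
  then have "topspace X - measure_support X \<mu> \<in> null_sets \<mu>"
    using measure_support_least(2)[OF assms] by (auto simp: null_sets_def regular_prob_sets[OF assms])
  then show ?thesis
    by (rule AE_I') (auto simp: regular_prob_sets[OF assms])
qed

text \<open>The operator \<open>A\<close> integrates a function over the fibres of \<open>\<rho>\<close>. A function that agrees on
  \<open>F\<close> with \<open>f \<circ> \<rho>\<close> has the constant value \<open>f x\<close> on the support of \<open>\<phi> x\<close>, so \<open>A\<close>
  returns \<open>f\<close>.\<close>

lemma averaging_operator:
  assumes K: "compact_space K" and F: "closedin K F"
    and \<phi>: "continuous_map M (weak_star_prob (subtopology K F)) \<phi>"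
    and supp: "\<And>x. x \<in> topspace M \<Longrightarrow> measure_support (subtopology K F) (\<phi> x) \<subseteq> {y \<in> F. \<rho> y = x}"
  obtains A where "linear_operator (cfun K) (cfun M) A" "positive_operator (cfun K) A"
    "A (indicator (topspace K)) = indicator (topspace M)"
    "\<And>f g. f \<in> cfun M \<Longrightarrow> g \<in> cfun K \<Longrightarrow> (\<And>y. y \<in> F \<Longrightarrow> g y = f (\<rho> y)) \<Longrightarrow> A g = f"
proof -
  let ?KF = "subtopology K F"
  have FK: "F \<subseteq> topspace K" using F by (rule closedin_subset)
  have compact: "compact_space ?KF"
    using K F by (simp add: closedin_compact_space compact_space_subtopology)
  define res where "res g y = (if y \<in> F then g y else 0)" for g :: "'a \<Rightarrow> real" and y
  have res: "res g \<in> cfun ?KF" if "g \<in> cfun K" for g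
    using cfun_cut_subset[OF that FK] by (simp add: res_def[abs_def])
  have \<phi>_prob: "\<phi> x \<in> regular_prob ?KF" if "x \<in> topspace M" for x
    using \<phi> that by (simp add: continuous_map_weak_star_prob)
  have int: "integrable (\<phi> x) (res g)" if "x \<in> topspace M" "g \<in> cfun K" for x g
    by (rule cfun_integrable[OF compact \<phi>_prob[OF that(1)] res[OF that(2)]])
  define A where "A g x = (if x \<in> topspace M then \<integral>y. res g y \<partial>(\<phi> x) else 0)" for g x
  have A_eq: "A g = f"
    if f: "f \<in> cfun M" and g: "g \<in> cfun K" and eq: "\<And>y. y \<in> F \<Longrightarrow> g y = f (\<rho> y)" for f g
  proof
    fix x
    show "A g x = f x"
    proof (cases "x \<in> topspace M")
      case x: True
      interpret prob_space "\<phi> x" by (rule regular_prob_sets(3)[OF \<phi>_prob[OF x]])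
      have "AE y in \<phi> x. res g y = f x"
        using AE_measure_support[OF \<phi>_prob[OF x]]
        by eventually_elim (use supp[OF x] eq in \<open>auto simp: res_def\<close>)
      then have "(\<integral>y. res g y \<partial>(\<phi> x)) = (\<integral>y. f x \<partial>(\<phi> x))"
        using int[OF x g] by (intro integral_cong_AE) auto
      then show ?thesis using x prob_space by (simp add: A_def)
    qed (simp add: A_def cfun_outside[OF f])
  qed
  show thesis
  proof (rule that[of A])
    show "linear_operator (cfun K) (cfun M) A"
      unfolding linear_operator_def
    proof (intro conjI ballI allI)
      show "A \<in> cfun K \<rightarrow> cfun M"
        using \<phi> res unfolding continuous_map_weak_star_prob A_def[abs_def]
        by (auto intro!: cfun_cut)
      show "A (\<lambda>x. f x + g x) = (\<lambda>x. A f x + A g x)" if f: "f \<in> cfun K" and g: "g \<in> cfun K" for f g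
      proof
        fix x
        have "res (\<lambda>y. f y + g y) = (\<lambda>y. res f y + res g y)" by (auto simp: res_def)
        then show "A (\<lambda>x. f x + g x) x = A f x + A g x"
          using int[OF _ f, of x] int[OF _ g, of x] by (auto simp: A_def)
      qed
      show "A (\<lambda>x. c * f x) = (\<lambda>x. c * A f x)" if f: "f \<in> cfun K" for c f
      proof
        fix x
        have "res (\<lambda>y. c * f y) = (\<lambda>y. c * res f y)" by (auto simp: res_def)
        then show "A (\<lambda>x. c * f x) x = c * A f x" by (auto simp: A_def)
      qed
    qed
    show "positive_operator (cfun K) A"
      unfolding positive_operator_def A_def by (auto simp: res_def)
    show "A (indicator (topspace K)) = indicator (topspace M)"
    proof
      fix x
      show "A (indicator (topspace K)) x = indicator (topspace M) x"
      proof (cases "x \<in> topspace M")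
        case x: True
        interpret prob_space "\<phi> x" by (rule regular_prob_sets(3)[OF \<phi>_prob[OF x]])
        have "(\<integral>y. res (indicator (topspace K)) y \<partial>(\<phi> x)) = (\<integral>y. 1 \<partial>(\<phi> x))"
          using FK regular_prob_sets(2)[OF \<phi>_prob[OF x]]
          by (intro Bochner_Integration.integral_cong) (auto simp: res_def)
        then show ?thesis using x prob_space by (simp add: A_def)
      qed (simp add: A_def)
    qed
  qed (rule A_eq)
qed

section \<open>Measures from a projection\<close>

text \<open>The points at which evaluating \<open>T f\<close> is evaluating \<open>f\<close> somewhere in \<open>M\<close>. The condition
  is closed on \<open>M \<times> K\<close>, and the projection along the compact factor \<open>M\<close> is a closed map.\<close>

lemma closedin_evaluation_points:
  fixes T :: "('b \<Rightarrow> real) \<Rightarrow> 'a \<Rightarrow> real"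
  assumes M: "compact_space M" and T: "\<And>f. f \<in> cfun M \<Longrightarrow> T f \<in> cfun K"
  shows "closedin K {y \<in> topspace K. \<exists>x\<in>topspace M. \<forall>f\<in>cfun M. T f y = f x}"
proof -
  let ?P = "prod_topology M K"
  let ?Z = "{p \<in> topspace ?P. \<forall>f\<in>cfun M. T f (snd p) = f (fst p)}"
  have "closedin ?P {p \<in> topspace ?P. T f (snd p) = f (fst p)}" if "f \<in> cfun M" for f
    using continuous_map_compose[OF continuous_map_snd cfun_continuous[OF T[OF that]], of M]
      continuous_map_compose[OF continuous_map_fst cfun_continuous[OF that], of K]
    by (intro closedin_eq) (simp_all add: o_def)
  then have "closedin ?P (\<Inter>f\<in>cfun M. {p \<in> topspace ?P. T f (snd p) = f (fst p)})"
    using cfun_zero by (intro closedin_Inter) auto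
  moreover have "(\<Inter>f\<in>cfun M. {p \<in> topspace ?P. T f (snd p) = f (fst p)}) = ?Z"
    using cfun_zero by auto
  ultimately have "closedin ?P ?Z" by (rule subst[where P = "closedin ?P", rotated])
  then have "closedin K (snd ` ?Z)"
    using closed_map_snd[OF M, of K] unfolding closed_map_def by blast
  moreover have "snd ` ?Z = {y \<in> topspace K. \<exists>x\<in>topspace M. \<forall>f\<in>cfun M. T f y = f x}"
    by (intro set_eqI iffI) (auto simp: image_iff)
  ultimately show ?thesis by simp
qed

text \<open>The state \<open>g \<mapsto> A g x\<close> lives on the points \<open>y\<close> where evaluating \<open>T f\<close> is
  evaluating \<open>f\<close> at \<open>x\<close>. Indeed, composed with \<open>T\<close> it is the evaluation at \<open>x\<close>, an
  extreme state. If \<open>T f y \<noteq> f x\<close>, then a nonnegative function in the kernel of the state is positive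
  at \<open>y\<close>: either \<open>1 - T 1\<close>, or \<open>T \<bar>f - f x\<bar>\<close>. By Dini, a function
  vanishing at the good points is dominated by \<open>\<epsilon>\<close> plus such kernel functions.\<close>

lemma section_concentrated:
  assumes K: "compact_space K" and M: "compact_space M"
    and T: "linear_operator (cfun M) (cfun K) T" "positive_operator (cfun M) T"
    and T1: "\<And>y. T (indicator (topspace M)) y \<le> indicator (topspace K) y"
    and A: "linear_operator (cfun K) (cfun M) A" "positive_operator (cfun K) A"
      "A (indicator (topspace K)) = indicator (topspace M)"
    and AT: "\<And>f. f \<in> cfun M \<Longrightarrow> A (T f) = f"
    and x: "x \<in> topspace M" and g: "g \<in> cfun K"
    and vanish: "\<And>y. y \<in> topspace K \<Longrightarrow> \<forall>f\<in>cfun M. T f y = f x \<Longrightarrow> g y = 0"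
  shows "A g x = 0"
proof -
  note TD = linear_operatorD[OF T(1)] and AD = linear_operatorD[OF A(1)]
  let ?uK = "indicator (topspace K) :: 'a \<Rightarrow> real" and ?uM = "indicator (topspace M) :: 'b \<Rightarrow> real"
  define H where "H = {h \<in> cfun K. (\<forall>y. 0 \<le> h y) \<and> A h x = 0}"
  have H_zero: "(\<lambda>y. 0) \<in> H" using AD(3)[OF cfun_zero, of 0] by (simp add: H_def cfun_zero)
  have H_add: "(\<lambda>y. h y + k y) \<in> H" if "h \<in> H" "k \<in> H" for h k
    using that by (simp add: H_def cfun_add AD(2))
  have H_scale: "(\<lambda>y. c * h y) \<in> H" if "h \<in> H" "0 \<le> c" for c h
    using that by (simp add: H_def cfun_scale AD(3))
  have detect: "\<exists>h\<in>H. 0 < h y"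
    if y: "y \<in> topspace K" and f: "f \<in> cfun M" and neq: "T f y \<noteq> f x" for y f
  proof (cases "T ?uM y = 1")
    case False
    have h: "(\<lambda>y. ?uK y - T ?uM y) \<in> H"
      using T1 by (simp add: H_def cfun_diff cfun_one TD(1) AD(4) A(3) AT)
    have "0 < ?uK y - T ?uM y" using T1[of y] y False by simp
    then show ?thesis by (rule bexI[where P = "\<lambda>h. 0 < h y", OF _ h])
  next
    case True
    define k where "k z = f z - f x * ?uM z" for z
    have k: "k \<in> cfun M" unfolding k_def by (intro cfun_diff f cfun_scale cfun_one)
    have k_abs: "(\<lambda>z. \<bar>k z\<bar>) \<in> cfun M" by (rule cfun_abs[OF k])
    have "T (\<lambda>z. \<bar>k z\<bar>) \<in> H"
      using T(2) k_abs TD(1) AT[OF k_abs] x unfolding positive_operator_def by (simp add: H_def k_def)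
    moreover have "T k y = T f y - f x"
      unfolding k_def using True by (simp add: TD f cfun_one cfun_scale)
    then have "0 < T (\<lambda>z. \<bar>k z\<bar>) y"
      using positive_operator_abs_le[OF T k k_abs, of y] neq by simp
    ultimately show ?thesis by blast
  qed
  have "\<bar>A g x\<bar> \<le> e" if e: "0 < e" for e
  proof -
    define G where "G = (\<lambda>h y. e * ?uK y + h y) ` H"
    obtain k where k: "k \<in> G" "\<And>y. y \<in> topspace K \<Longrightarrow> \<bar>g y\<bar> < k y"
    proof (rule dini_directed[OF K cfun_continuous[OF cfun_abs[OF g]], of G])
      show "continuous_map K euclideanreal k" if "k \<in> G" for k
      proof -
        obtain h where "h \<in> H" "k = (\<lambda>y. e * ?uK y + h y)" using \<open>k \<in> G\<close> by (auto simp: G_def)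
        then show ?thesis by (simp add: H_def cfun_continuous cfun_add cfun_scale cfun_one)
      qed
      show "G \<noteq> {}" using H_zero by (auto simp: G_def)
      show "\<exists>l\<in>G. \<forall>y\<in>topspace K. h y \<le> l y \<and> k y \<le> l y" if hk: "h \<in> G" "k \<in> G" for h k
      proof -
        obtain h' k' where h': "h' \<in> H" "h = (\<lambda>y. e * ?uK y + h' y)" and k': "k' \<in> H" "k = (\<lambda>y. e * ?uK y + k' y)"
          using hk by (auto simp: G_def)
        have hk': "(\<lambda>y. e * ?uK y + (h' y + k' y)) \<in> G" unfolding G_def by (rule imageI[OF H_add[OF h'(1) k'(1)]])
        show ?thesis using h' k' by (intro bexI[OF _ hk']) (simp add: H_def)
      qed
      show "\<exists>k\<in>G. \<bar>g y\<bar> < k y" if y: "y \<in> topspace K" for y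
      proof (cases "\<forall>f\<in>cfun M. T f y = f x")
        case True
        then have "g y = 0" using vanish[OF y] by simp
        moreover have "(\<lambda>y. e * ?uK y + 0) \<in> G" unfolding G_def by (rule imageI[OF H_zero])
        ultimately show ?thesis using e y by (intro bexI[of _ "\<lambda>y. e * ?uK y + 0"]) simp_all
      next
        case False
        then obtain h where h: "h \<in> H" "0 < h y" using detect[OF y] by blast
        have "(\<lambda>z. (\<bar>g y\<bar> / h y) * h z) \<in> H" using h by (intro H_scale) auto
        then have k: "(\<lambda>z. e * ?uK z + (\<bar>g y\<bar> / h y) * h z) \<in> G" unfolding G_def by (rule imageI)
        have "\<bar>g y\<bar> < e * ?uK y + (\<bar>g y\<bar> / h y) * h y" using h e y by simp
        then show ?thesis by (rule bexI[where P = "\<lambda>k. \<bar>g y\<bar> < k y", OF _ k])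
      qed
    qed (use that in blast)
    then obtain h where h: "h \<in> H" "k = (\<lambda>y. e * ?uK y + h y)" by (auto simp: G_def)
    have hK: "h \<in> cfun K" "A h x = 0" using h(1) by (auto simp: H_def)
    have kK: "k \<in> cfun K" unfolding h(2) by (intro cfun_add cfun_scale cfun_one hK)
    have "\<bar>g y\<bar> \<le> k y" for y
      using k(2)[of y] cfun_outside[OF g, of y] cfun_outside[OF kK, of y] by (cases "y \<in> topspace K") auto
    then have "\<bar>A g x\<bar> \<le> A k x" by (intro positive_operator_abs_le[OF A(1,2) g kK])
    also have "A k x = e"
      unfolding h(2) using x by (simp add: AD cfun_scale cfun_one hK A(3))
    finally show ?thesis .
  qed
  then have "\<bar>A g x\<bar> \<le> 0" by (rule field_le_epsilon) simp
  then show ?thesis by simp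
qed

text \<open>Let \<open>F\<close> consist of the points of \<open>K\<close> at which \<open>T\<close> is evaluation at a point
  \<open>\<rho> y\<close> of \<open>L\<close>; the functions \<open>T (d x \<cdot>)\<close> equal \<open>d x (\<rho> y)\<close> on \<open>F\<close> and
  make \<open>\<rho>\<close> continuous. As \<open>A g x\<close> depends only on the values of \<open>g\<close> on \<open>F\<close>, it defines a
  state on \<open>\<C>(F)\<close> via Tietze extensions, and \<open>\<phi> x\<close> is its Riesz measure. The integral of
  \<open>d x (\<rho> y)\<close> against \<open>\<phi> x\<close> is \<open>A (T (d x \<cdot>)) x = d x x = 0\<close>, so \<open>\<phi> x\<close> lives on
  the fibre over \<open>x\<close>; that fibre is nonempty because it has measure 1.\<close>

lemma representing_measures:
  fixes K :: "'a topology" and L :: "'b set"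
  assumes K: "compact_space K" "Hausdorff_space K"
    and "Metric_space L d" and L: "compact_space (Metric_space.mtopology L d)"
    and T: "linear_operator (cfun (Metric_space.mtopology L d)) (cfun K) T"
      "positive_operator (cfun (Metric_space.mtopology L d)) T"
    and T1: "\<And>y. T (indicator L) y \<le> indicator (topspace K) y"
    and A: "linear_operator (cfun K) (cfun (Metric_space.mtopology L d)) A" "positive_operator (cfun K) A"
      "A (indicator (topspace K)) = indicator L"
    and AT: "\<And>f. f \<in> cfun (Metric_space.mtopology L d) \<Longrightarrow> A (T f) = f"
  shows "\<exists>F \<rho> \<phi>. closedin K F \<and>
            continuous_map (subtopology K F) (Metric_space.mtopology L d) \<rho> \<and> \<rho> ` F = L \<and>
            continuous_map (Metric_space.mtopology L d) (weak_star_prob (subtopology K F)) \<phi> \<and>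
            (\<forall>x\<in>L. measure_support (subtopology K F) (\<phi> x) \<subseteq> {y\<in>F. \<rho> y = x})"
proof -
  interpret Metric_space L d by fact
  note TD = linear_operatorD[OF T(1)] and AD = linear_operatorD[OF A(1)]
  define F where "F = {y \<in> topspace K. \<exists>x\<in>topspace mtopology. \<forall>f\<in>cfun mtopology. T f y = f x}"
  let ?KF = "subtopology K F"
  have F: "closedin K F"
    unfolding F_def by (rule closedin_evaluation_points[OF L TD(1)])
  have FK: "F \<subseteq> topspace K" using F by (rule closedin_subset)
  then have tF: "topspace ?KF = F" by auto
  have KF: "compact_space ?KF" "Hausdorff_space ?KF"
    using K F by (simp_all add: closedin_compact_space compact_space_subtopology Hausdorff_space_subtopology)
  define \<rho> where "\<rho> y = (SOME x. x \<in> L \<and> (\<forall>f\<in>cfun mtopology. T f y = f x))" for y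
  have \<rho>: "\<rho> y \<in> L" "\<And>f. f \<in> cfun mtopology \<Longrightarrow> T f y = f (\<rho> y)" if "y \<in> F" for y
    using someI_ex[of "\<lambda>x. x \<in> L \<and> (\<forall>f\<in>cfun mtopology. T f y = f x)"] that
    by (auto simp: F_def \<rho>_def)
  define dist_from where "dist_from x z = (if z \<in> topspace mtopology then d x z else 0)" for x z
  have dist_from: "dist_from x \<in> cfun mtopology" if "x \<in> L" for x
    unfolding dist_from_def[abs_def] using that by (intro cfun_cut continuous_map_distance) auto
  have T_dist: "T (dist_from x) y = d x (\<rho> y)" if "x \<in> L" "y \<in> F" for x y
    using \<rho>[OF that(2)] dist_from[OF that(1)] by (simp add: dist_from_def)
  have \<rho>_cont: "continuous_map ?KF mtopology \<rho>"
    unfolding continuous_map_to_metric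
  proof (intro ballI allI impI)
    fix y and e :: real assume "y \<in> topspace ?KF" and e: "0 < e"
    then have y: "y \<in> F" using tF by simp
    have c: "continuous_map ?KF euclideanreal (T (dist_from (\<rho> y)))"
      by (rule continuous_map_from_subtopology[OF cfun_continuous[OF TD(1)[OF dist_from[OF \<rho>(1)[OF y]]]]])
    let ?U = "{z \<in> topspace ?KF. T (dist_from (\<rho> y)) z < e}"
    have "openin ?KF ?U" using c by (intro openin_less) auto
    moreover have "y \<in> ?U" using y e tF T_dist[OF \<rho>(1)[OF y] y] \<rho>(1)[OF y] by simp
    moreover have "\<rho> z \<in> mball (\<rho> y) e" if "z \<in> ?U" for z
      using that tF T_dist[OF \<rho>(1)[OF y], of z] \<rho>(1)[OF y] \<rho>(1)[of z] by simp
    ultimately show "\<exists>U. openin ?KF U \<and> y \<in> U \<and> (\<forall>z\<in>U. \<rho> z \<in> mball (\<rho> y) e)" by blast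
  qed

  have A_local: "A g x = A h x"
    if g: "g \<in> cfun K" and h: "h \<in> cfun K" and x: "x \<in> L" and eq: "\<And>y. y \<in> F \<Longrightarrow> g y = h y" for g h x
  proof -
    have "A (\<lambda>y. g y - h y) x = 0"
    proof (rule section_concentrated[OF K(1) L T _ A(1,2) _ AT])
      show "x \<in> topspace mtopology" using x by simp
      show "(\<lambda>y. g y - h y) \<in> cfun K" by (rule cfun_diff[OF g h])
      show "g y - h y = 0" if "y \<in> topspace K" "\<forall>f\<in>cfun mtopology. T f y = f x" for y
        using eq[of y] that x by (auto simp: F_def)
    qed (use T1 A(3) in simp_all)
    then show ?thesis by (simp add: AD(4)[OF g h])
  qed
  have "\<exists>g\<in>cfun K. \<forall>y\<in>F. g y = h y" if h: "h \<in> cfun ?KF" for h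
  proof -
    have "normal_space K" using K by (simp add: compact_Hausdorff_or_regular_imp_normal_space)
    then obtain g where "continuous_map K euclideanreal g" "\<And>y. y \<in> F \<Longrightarrow> g y = h y"
      using Tietze_extension_realinterval[OF _ F is_interval_univ UNIV_not_empty cfun_continuous[OF h]] by auto
    then show ?thesis using FK by (intro bexI[OF _ cfun_cut[of K g]]) auto
  qed
  then obtain ext where ext: "\<And>h. h \<in> cfun ?KF \<Longrightarrow> ext h \<in> cfun K" "\<And>h y. h \<in> cfun ?KF \<Longrightarrow> y \<in> F \<Longrightarrow> ext h y = h y"
    by metis
  define \<Lambda> where "\<Lambda> x h = A (ext h) x" for x h
  have \<Lambda>_eq: "\<Lambda> x h = A g x"
    if "x \<in> L" "h \<in> cfun ?KF" "g \<in> cfun K" "\<And>y. y \<in> F \<Longrightarrow> h y = g y" for x h g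
    unfolding \<Lambda>_def using that ext[OF that(2)] by (intro A_local) auto
  have state: "cfun_state ?KF (\<Lambda> x)" if x: "x \<in> L" for x
  proof
    show "compact_space ?KF" "Hausdorff_space ?KF" by (rule KF)+
    show "\<Lambda> x (\<lambda>y. f y + g y) = \<Lambda> x f + \<Lambda> x g" if f: "f \<in> cfun ?KF" and g: "g \<in> cfun ?KF" for f g
    proof -
      have "\<Lambda> x (\<lambda>y. f y + g y) = A (\<lambda>y. ext f y + ext g y) x"
        using ext[OF f] ext[OF g] by (intro \<Lambda>_eq x cfun_add f g) auto
      then show ?thesis by (simp add: AD(2) ext f g \<Lambda>_def)
    qed
    show "\<Lambda> x (\<lambda>y. c * f y) = c * \<Lambda> x f" if f: "f \<in> cfun ?KF" for c f
    proof -
      have "\<Lambda> x (\<lambda>y. c * f y) = A (\<lambda>y. c * ext f y) x"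
        using ext[OF f] by (intro \<Lambda>_eq x cfun_scale f) auto
      then show ?thesis by (simp add: AD(3) ext f \<Lambda>_def)
    qed
    \<comment> \<open>the chosen extension may take negative values off \<open>F\<close>; its absolute value is another extension\<close>
    show "0 \<le> \<Lambda> x f" if f: "f \<in> cfun ?KF" "\<And>y. 0 \<le> f y" for f
    proof -
      have abs: "(\<lambda>y. \<bar>ext f y\<bar>) \<in> cfun K" by (rule cfun_abs[OF ext(1)[OF f(1)]])
      have "\<Lambda> x f = A (\<lambda>y. \<bar>ext f y\<bar>) x"
        using ext(2)[OF f(1)] f(2) by (intro \<Lambda>_eq x f(1) abs) auto
      then show ?thesis using A(2) abs unfolding positive_operator_def by simp
    qed
    have "\<Lambda> x (indicator (topspace ?KF)) = A (indicator (topspace K)) x"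
      using FK by (intro \<Lambda>_eq x cfun_one) (auto simp: tF)
    then show "\<Lambda> x (indicator (topspace ?KF)) = 1" using x by (simp add: A(3))
  qed
  define \<phi> where "\<phi> x = cfun_state.riesz_measure ?KF (\<Lambda> x)" for x
  have \<phi>_prob: "\<phi> x \<in> regular_prob ?KF" if "x \<in> L" for x
    unfolding \<phi>_def by (rule cfun_state.riesz_regular_prob[OF state[OF that]])
  have \<phi>_int: "(\<integral>y. h y \<partial>(\<phi> x)) = A (ext h) x" if "x \<in> L" "h \<in> cfun ?KF" for x h
    unfolding \<phi>_def using cfun_state.riesz_representation[OF state[OF that(1)] that(2)] by (simp add: \<Lambda>_def)
  have \<phi>_cont: "continuous_map mtopology (weak_star_prob ?KF) \<phi>"
    unfolding continuous_map_weak_star_prob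
  proof (intro conjI ballI)
    show "\<phi> x \<in> regular_prob ?KF" if "x \<in> topspace mtopology" for x using \<phi>_prob that by simp
    fix h assume h: "h \<in> cfun ?KF"
    show "continuous_map mtopology euclideanreal (\<lambda>x. \<integral>y. h y \<partial>(\<phi> x))"
      by (rule continuous_map_eq[OF cfun_continuous[OF AD(1)[OF ext(1)[OF h]]]]) (simp add: \<phi>_int h)
  qed
  have fibre: "closedin ?KF {y \<in> F. \<rho> y = x}" "emeasure (\<phi> x) (topspace ?KF - {y \<in> F. \<rho> y = x}) = 0"
    if x: "x \<in> L" for x
  proof -
    let ?k = "\<lambda>y. if y \<in> F then T (dist_from x) y else 0"
    have k: "?k \<in> cfun ?KF"
      by (rule cfun_cut_subset[OF TD(1)[OF dist_from[OF x]] FK])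
    have k_eq: "?k y = d x (\<rho> y)" if "y \<in> F" for y using that T_dist[OF x that] by simp
    have zero: "{y \<in> F. \<rho> y = x} = {y \<in> topspace ?KF. ?k y = 0}"
      using k_eq \<rho>(1) x tF by (auto simp del: topspace_subtopology)
    show closed: "closedin ?KF {y \<in> F. \<rho> y = x}"
      unfolding zero using cfun_continuous[OF k] by (intro closedin_eq) auto
    have "(\<integral>y. ?k y \<partial>(\<phi> x)) = A (ext ?k) x" by (rule \<phi>_int[OF x k])
    also have "\<dots> = A (T (dist_from x)) x"
      using ext(2)[OF k] by (intro A_local ext(1) k TD(1) dist_from x) auto
    also have "\<dots> = 0" using x by (simp add: AT dist_from) (simp add: dist_from_def)
    finally have "(\<integral>y. ?k y \<partial>(\<phi> x)) = 0" .
    moreover have "AE y in \<phi> x. 0 \<le> ?k y" using k_eq by (intro AE_I2) auto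
    ultimately have "AE y in \<phi> x. ?k y = 0"
      using integral_nonneg_eq_0_iff_AE[OF cfun_integrable[OF KF(1) \<phi>_prob[OF x] k]] by simp
    then have "emeasure (\<phi> x) {y \<in> space (\<phi> x). ?k y \<noteq> 0} = 0"
      by (subst (asm) AE_iff_measurable[OF _ refl])
         (use cfun_measurable[OF \<phi>_prob[OF x] k] in simp_all)
    moreover have "{y \<in> space (\<phi> x). ?k y \<noteq> 0} = topspace ?KF - {y \<in> F. \<rho> y = x}"
      unfolding zero regular_prob_sets(2)[OF \<phi>_prob[OF x]] by blast
    ultimately show "emeasure (\<phi> x) (topspace ?KF - {y \<in> F. \<rho> y = x}) = 0" by simp
  qed
  have supp: "measure_support ?KF (\<phi> x) \<subseteq> {y \<in> F. \<rho> y = x}" if "x \<in> L" for x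
    by (rule measure_support_least(3)[OF \<phi>_prob[OF that] fibre[OF that]])
  have "\<rho> ` F = L"
  proof (intro equalityI subsetI)
    fix x assume x: "x \<in> L"
    interpret prob_space "\<phi> x" by (rule regular_prob_sets(3)[OF \<phi>_prob[OF x]])
    have "{y \<in> F. \<rho> y = x} \<noteq> {}"
    proof
      assume "{y \<in> F. \<rho> y = x} = {}"
      then have "emeasure (\<phi> x) (space (\<phi> x)) = 0"
        using fibre(2)[OF x] by (simp only: Diff_empty regular_prob_sets(2)[OF \<phi>_prob[OF x]])
      then show False using emeasure_space_1 by simp
    qed
    then show "x \<in> \<rho> ` F" by auto
  qed (use \<rho>(1) in auto)
  then show ?thesis using F \<rho>_cont \<phi>_cont supp by blast
qed

section \<open>The equivalence\<close>

theorem theorem1p3: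
  fixes K :: "'a topology" and L :: "'b set" and d :: "'b \<Rightarrow> 'b \<Rightarrow> real"
  assumes "compact_space K" and "Hausdorff_space K"
    and "Metric_space L d" and "compact_space (Metric_space.mtopology L d)" and "L \<noteq> {}"
  shows "(\<exists>E T P. closed_linear_subspace K E \<and>
            surjective_isometry (Metric_space.mtopology L d) K E T \<and>
            positive_operator (cfun (Metric_space.mtopology L d)) T \<and>
            projection_onto K E P \<and> positive_operator (cfun K) P \<and> operator_norm K K P = 1)
     \<longleftrightarrow>
         (\<exists>F \<rho> \<phi>. closedin K F \<and>
            continuous_map (subtopology K F) (Metric_space.mtopology L d) \<rho> \<and> \<rho> ` F = L \<and>
            continuous_map (Metric_space.mtopology L d) (weak_star_prob (subtopology K F)) \<phi> \<and>
            (\<forall>x\<in>L. measure_support (subtopology K F) (\<phi> x) \<subseteq> {y\<in>F. \<rho> y = x}))"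
  (is "?operators \<longleftrightarrow> ?measures")
proof
  interpret Metric_space L d by fact
  assume ?operators
  then obtain E T P where E: "closed_linear_subspace K E" and T: "surjective_isometry mtopology K E T"
      "positive_operator (cfun mtopology) T"
    and P: "projection_onto K E P" "positive_operator (cfun K) P" "operator_norm K K P = 1" by blast
  have "E \<subseteq> cfun K" using E by (simp add: closed_linear_subspace_def)
  then obtain A where "linear_operator (cfun mtopology) (cfun K) T"
      "\<And>y. T (indicator L) y \<le> indicator (topspace K) y"
      "linear_operator (cfun K) (cfun mtopology) A" "positive_operator (cfun K) A"
      "A (indicator (topspace K)) = indicator L" "\<And>f. f \<in> cfun mtopology \<Longrightarrow> A (T f) = f"
    using section_from_projection[OF assms(1,4) _ T P] by auto
  then show ?measures using T(2) by (intro representing_measures[OF assms(1-4)])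
next
  interpret Metric_space L d by fact
  assume ?measures
  then obtain F \<rho> \<phi> where F: "closedin K F" and \<rho>: "continuous_map (subtopology K F) mtopology \<rho>"
    and \<phi>: "continuous_map mtopology (weak_star_prob (subtopology K F)) \<phi>"
    and supp: "\<And>x. x \<in> L \<Longrightarrow> measure_support (subtopology K F) (\<phi> x) \<subseteq> {y\<in>F. \<rho> y = x}" by blast
  obtain T where T: "linear_operator (cfun mtopology) (cfun K) T" "positive_operator (cfun mtopology) T"
      "T (indicator L) = indicator (topspace K)"
    and T_F: "\<And>f y. f \<in> cfun mtopology \<Longrightarrow> y \<in> F \<Longrightarrow> T f y = f (\<rho> y)"
    using positive_extension_operator[OF assms F \<rho>] by blast
  obtain A where A: "linear_operator (cfun K) (cfun mtopology) A" "positive_operator (cfun K) A"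
      "A (indicator (topspace K)) = indicator (topspace mtopology)"
    and A_eq: "\<And>f g. f \<in> cfun mtopology \<Longrightarrow> g \<in> cfun K \<Longrightarrow> (\<And>y. y \<in> F \<Longrightarrow> g y = f (\<rho> y)) \<Longrightarrow> A g = f"
    using averaging_operator[OF assms(1) F \<phi>, of \<rho>] supp by auto
  have "A (T f) = f" if "f \<in> cfun mtopology" for f
    using that T_F linear_operatorD(1)[OF T(1)] by (intro A_eq) auto
  then show ?operators
    using assms(5) T by (intro projection_from_section[OF assms(1,4) _ T(1,2) _ A]) auto
qed

end
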